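(* Let $d,\alpha\in\mathbb{N}$ and let $[\boldsymbol a,\boldsymbol b]=\prod_{j=1}^d[a_j,b_j]$ be a box in $\mathbb{R}^d$. For a function $f$ on $[\boldsymbol a,\boldsymbol b]$ having mixed partial derivatives up to order $\alpha-1$ in each variable which are absolutely continuous and of which the derivatives with the highest order $\alpha$ are integrable, we have the following equivalent representations for all $\boldsymbol x\in[\boldsymbol a,\boldsymbol b]$: (i) series representation in terms of Bernoulli polynomials with remainder term $$f(\boldsymbol x)=\sum_{\emptyset\ne\mathfrak u\subseteq\{1,\ldots,d\}}(-1)^{|\mathfrak u|+1}\sum_{\substack{\boldsymbol\tau_{\mathfrak u}\in\{0,\ldots,\alpha\}^{|\mathfrak u|}\\ \tau_j=0\text{ for }j\notin\mathfrak u}}\left[\prod_{j\in\mathfrak u}\frac{B^{[a_j,b_j]}_{\tau_j}(x_j)}{\tau_j!}\right]\int_{[\boldsymbol a_{\mathfrak u},\boldsymbol b_{\mathfrak u}]}f^{(\boldsymbol\tau)}(\boldsymbol x_{-\mathfrak u},\boldsymbol y_{\mathfrak u})\,\mathrm{d}\boldsymbol y_{\mathfrak u}+(-1)^d\int_{[\boldsymbol a,\boldsymbol b]}\left[\prod_{j=1}^d\frac{\widetilde B^{[a_j,b_j]}_\alpha(x_j-y_j+a_j)}{\alpha!}\right]f^{(\alpha,\ldots,\alpha)}(\boldsymbol y)\,\mathrm{d}\boldsymbol y;$$ (ii) series representation in terms of Bernoulli polynomials with mixed remainder terms $$f(\boldsymbol x)=\sum_{\mathfrak u\subseteq\{1,\ldots,d\}}(-1)^{d-|\mathfrak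 u|}\sum_{\substack{\boldsymbol\tau_{\mathfrak u}\in\{0,\ldots,\alpha\}^{|\mathfrak u|}\\ \tau_j=\alpha\text{ for }j\notin\mathfrak u}}\left[\prod_{j\in\mathfrak u}\frac{B^{[a_j,b_j]}_{\tau_j}(x_j)}{\tau_j!}\right]\int_{[\boldsymbol a,\boldsymbol b]}\left[\prod_{j\notin\mathfrak u}\frac{\widetilde B^{[a_j,b_j]}_\alpha(x_j-y_j+a_j)}{\alpha!}\right]f^{(\boldsymbol\tau)}(\boldsymbol y)\,\mathrm{d}\boldsymbol y.$$
   Context: Notation: $f^{(\boldsymbol\tau)}=\partial^{\tau_1+\cdots+\tau_d}f/\partial x_1^{\tau_1}\cdots\partial x_d^{\tau_d}$; $a_j<b_j$ finite. For $\mathfrak u\subseteq\{1,\ldots,d\}$, $-\mathfrak u$ is its complement, $\boldsymbol x_{\mathfrak u}=(x_j)_{j\in\mathfrak u}$, $[\boldsymbol a_{\mathfrak u},\boldsymbol b_{\mathfrak u}]=\prod_{j\in\mathfrak u}[a_j,b_j]$, and $(\boldsymbol x_{-\mathfrak u},\boldsymbol y_{\mathfrak u})$ is the vector with components $y_j$ for $j\in\mathfrak u$ and $x_j$ for $j\notin\mathfrak u$. In each sum, $\boldsymbol\tau_{\mathfrak u}$ together with the prescribed values for $j\notin\mathfrak u$ forms the multi-index $\boldsymbol\tau$. With $B_\tau$ the Bernoulli polynomial of degree $\tau$, the scaled Bernoulli polynomials are $B^{[a,b]}_\tau(x)=(b-a)^{\tau-1}B_\tau((x-a)/(b-a))$ (so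 $B^{[a,b]}_0=1/(b-a)$), and $\widetilde B^{[a,b]}_\tau$ is the $(b-a)$-periodic function equal to $B^{[a,b]}_\tau$ on $[a,b]$ for $\tau\ge2$ and on $(a,b)$ for $\tau=1$. Absolute continuity is used in each variable on the interval, so that the fundamental theorem of calculus holds in that variable; derivatives involving order $\alpha$ exist almost everywhere.
   Formalization: Mixed derivatives of order α in some variables must also, for a.e. value of those variables, be absolutely continuous in each variable of order below α, with the next mixed derivative as derivative; otherwise max(x1−x2,0) with d=2, α=1 is a counterexample. *)

theory Defs
  imports "HOL-Analysis.Analysis"
begin

text \<open>
  For a set of coordinates \<open>u\<close>, vectors \<open>x\<^sub>u\<close> are extensional functions on \<open>u\<close>, so that
  points of \<open>\<real>\<^sup>d\<close> are the elements of \<open>{1..d} \<rightarrow>\<^sub>E UNIV\<close>, and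
  \<open>merge ({1..d} - u) u (x, y)\<close> is the vector with components \<open>y j\<close> for \<open>j \<in> u\<close>
  and \<open>x j\<close> for the other \<open>j\<close>.
\<close>

definition box_on :: "nat set \<Rightarrow> (nat \<Rightarrow> real) \<Rightarrow> (nat \<Rightarrow> real) \<Rightarrow> (nat \<Rightarrow> real) set" where
  "box_on u a b = (\<Pi>\<^sub>E j\<in>u. {a j..b j})"

definition leb_on :: "nat set \<Rightarrow> (nat \<Rightarrow> real) measure" where
  "leb_on u = completion (\<Pi>\<^sub>M j\<in>u. lborel)"


section \<open>Mixed partial derivatives on a box\<close>

text \<open>The derivative is one-sided at the end points of \<open>[a j, b j]\<close>.\<close>

definition partial_deriv ::
  "(nat \<Rightarrow> real) \<Rightarrow> (nat \<Rightarrow> real) \<Rightarrow> nat \<Rightarrow> ((nat \<Rightarrow> real) \<Rightarrow> real) \<Rightarrow> (nat \<Rightarrow> real) \<Rightarrow> real" where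
  "partial_deriv a b j g x =
     vector_derivative (\<lambda>t. g (x(j := t))) (at (x j) within {a j..b j})"

text \<open>
  The derivatives are taken in the order of the notation: first \<open>\<tau> d\<close> times in variable \<open>d\<close>,
  last \<open>\<tau> 1\<close> times in variable \<open>1\<close>. Where a derivative does not exist the value is
  unspecified; existence is part of \<open>mixed_abs_cont\<close> below.
\<close>

definition mixed_deriv ::
  "nat \<Rightarrow> (nat \<Rightarrow> real) \<Rightarrow> (nat \<Rightarrow> real) \<Rightarrow> (nat \<Rightarrow> nat) \<Rightarrow> ((nat \<Rightarrow> real) \<Rightarrow> real) \<Rightarrow> (nat \<Rightarrow> real) \<Rightarrow> real" where
  "mixed_deriv d a b \<tau> f = foldr (\<lambda>j. partial_deriv a b j ^^ \<tau> j) [1..<Suc d] f"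


section \<open>Absolute continuity and the function class\<close>

definition abs_cont_on :: "real \<Rightarrow> real \<Rightarrow> (real \<Rightarrow> real) \<Rightarrow> bool" where
  "abs_cont_on l r g \<longleftrightarrow>
     (\<forall>\<epsilon>>0. \<exists>\<delta>>0. \<forall>D. finite D \<and> (\<forall>(s, t)\<in>D. l \<le> s \<and> s \<le> t \<and> t \<le> r) \<and>
        disjoint_family_on (\<lambda>(s, t). {s<..<t}) D \<and> (\<Sum>(s, t)\<in>D. t - s) < \<delta>
        \<longrightarrow> (\<Sum>(s, t)\<in>D. \<bar>g t - g s\<bar>) < \<epsilon>)"

text \<open>
  \<open>f\<^sup>(\<^sup>\<tau>\<^sup>)\<close> need only exist for almost every value of the coordinates \<open>S\<close> in which it has the
  highest order \<open>\<alpha>\<close>. For these values and every value of the other coordinates, it has to be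
  absolutely continuous in each variable \<open>j\<close> with \<open>\<tau> j < \<alpha>\<close>, and its derivative in that variable
  has to be the next mixed derivative, almost everywhere if that has order \<open>\<alpha>\<close> in \<open>j\<close>, and
  everywhere otherwise. Absolute continuity in single variables of the \<open>f\<^sup>(\<^sup>\<tau>\<^sup>)\<close> with all
  \<open>\<tau> j < \<alpha>\<close> would not suffice: on the unit square with \<open>\<alpha> = 1\<close>, \<open>max (x\<^sub>1 - x\<^sub>2) 0\<close> is
  Lipschitz and has \<open>f\<^sup>(\<^sup>1\<^sup>,\<^sup>1\<^sup>) = 0\<close> almost everywhere, but it is not a sum of functions
  of one variable.
\<close>

definition mixed_abs_cont ::
  "nat \<Rightarrow> nat \<Rightarrow> (nat \<Rightarrow> real) \<Rightarrow> (nat \<Rightarrow> real) \<Rightarrow> ((nat \<Rightarrow> real) \<Rightarrow> real) \<Rightarrow> bool" where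
  "mixed_abs_cont d \<alpha> a b f \<longleftrightarrow>
     (\<forall>\<tau>\<in>{1..d} \<rightarrow>\<^sub>E {0..\<alpha>}. \<forall>j\<in>{1..d}. \<tau> j < \<alpha> \<longrightarrow>
        (let S = {k\<in>{1..d}. \<tau> k = \<alpha>} in
         AE z in leb_on S. z \<in> box_on S a b \<longrightarrow>
           (\<forall>x\<in>box_on {1..d} a b.
              let p = (\<lambda>t. (merge ({1..d} - S) S (x, z))(j := t));
                  g = (\<lambda>t. mixed_deriv d a b \<tau> f (p t));
                  h = (\<lambda>t. mixed_deriv d a b (\<tau>(j := Suc (\<tau> j))) f (p t))
              in abs_cont_on (a j) (b j) g \<and>
                 (if Suc (\<tau> j) < \<alpha>
                  then \<forall>t\<in>{a j..b j}. (g has_vector_derivative h t) (at t within {a j..b j})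
                  else AE t in lebesgue. t \<in> {a j..b j} \<longrightarrow>
                         (g has_vector_derivative h t) (at t within {a j..b j})))))"

definition top_derivs_integrable ::
  "nat \<Rightarrow> nat \<Rightarrow> (nat \<Rightarrow> real) \<Rightarrow> (nat \<Rightarrow> real) \<Rightarrow> ((nat \<Rightarrow> real) \<Rightarrow> real) \<Rightarrow> bool" where
  "top_derivs_integrable d \<alpha> a b f \<longleftrightarrow>
     (\<forall>\<tau>\<in>{1..d} \<rightarrow>\<^sub>E {0..\<alpha>}. (\<exists>j\<in>{1..d}. \<tau> j = \<alpha>) \<longrightarrow>
        set_integrable (leb_on {1..d}) (box_on {1..d} a b) (mixed_deriv d a b \<tau> f))"


section \<open>Scaled Bernoulli polynomials\<close>

fun bernoulli_num :: "nat \<Rightarrow> real" where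
  "bernoulli_num n =
     (if n = 0 then 1
      else - (\<Sum>k<n. real (Suc n choose k) * bernoulli_num k) / real (Suc n))"

declare bernoulli_num.simps [simp del]

definition bernoulli_poly :: "nat \<Rightarrow> real \<Rightarrow> real" where
  "bernoulli_poly n x = (\<Sum>k\<le>n. real (n choose k) * bernoulli_num k * x ^ (n - k))"

definition scaled_bernoulli :: "real \<Rightarrow> real \<Rightarrow> nat \<Rightarrow> real \<Rightarrow> real" where
  "scaled_bernoulli l r n x = (r - l) powi (int n - 1) * bernoulli_poly n ((x - l) / (r - l))"

text \<open>
  For \<open>n = 1\<close> the periodic function has jumps at \<open>l + k (r - l)\<close>, where this definition takes the
  value on the right; the function is only used under an integral.
\<close>

definition periodic_bernoulli :: "real \<Rightarrow> real \<Rightarrow> nat \<Rightarrow> real \<Rightarrow> real" where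
  "periodic_bernoulli l r n x = scaled_bernoulli l r n (l + (r - l) * frac ((x - l) / (r - l)))"

end

theory Submission
  imports Defs
begin

text \<open>
  The proof iterates an expansion in one variable. If \<open>g\<close> has absolutely continuous derivatives
  up to order \<open>\<alpha> - 1\<close> on \<open>[l, r]\<close>, repeated integration by parts of
  \<open>\<integral> B~\<^sub>n (x - y + l) g\<^sup>(\<^sup>n\<^sup>) (y) dy / n!\<close> (with \<open>B~\<^sub>n\<close> the periodic Bernoulli function) gives
  \<open>g (x) = (\<Sum>k\<le>\<alpha>. B\<^sub>k (x) / k! \<integral> g\<^sup>(\<^sup>k\<^sup>)) - \<integral> B~\<^sub>\<alpha> (x - y + l) g\<^sup>(\<^sup>\<alpha>\<^sup>) (y) dy / \<alpha>!\<close>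
  (\<open>bernoulli_expansion\<close>). Here \<open>B\<^sub>n\<close> has equal values at the end points of the interval except for
  \<open>n = 1\<close>, where the jump \<open>1\<close> produces \<open>g (x)\<close>. The integration by parts needs the fundamental
  theorem of calculus for absolutely continuous functions (\<open>abs_cont_fundamental_theorem\<close>), which
  is proved for the Henstock-Kurzweil integral.

  In several variables, write \<open>id = P\<^sub>j + R\<^sub>j\<close> for this expansion in the variable \<open>j\<close>, where \<open>P\<^sub>j\<close>
  is the polynomial part and \<open>R\<^sub>j\<close> the remainder. For disjoint sets \<open>w\<close> and \<open>v\<close> of variables,
  \<open>mixed_term x w v\<close> is what the product of the \<open>P\<^sub>j\<close> with \<open>j \<in> w\<close> and the \<open>R\<^sub>j\<close> with \<open>j \<in> v\<close> makes
  of \<open>f\<close>. It satisfies \<open>T w v = T (insert j w) v + T w (insert j v)\<close> for every further \<open>j\<close>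
  (\<open>mixed_term_recurrence\<close>). By induction over the set of variables, this gives
  \<open>T {} {} = (\<Sum>u\<subseteq>D. T u (D - u))\<close>, which is the second representation, and
  \<open>T {} D = (\<Sum>u\<subseteq>D. (-1)\<^sup>|\<^sup>u\<^sup>| T u {})\<close>, which is the first one.

  The analytic work is to justify the recurrence. The expansion in the variable \<open>j\<close> holds only for
  almost every value of the variables that are integrated already, and Fubini's theorem needs
  every section \<open>y \<mapsto> f\<^sup>(\<^sup>\<tau>\<^sup>) (x, y)\<close>, in which the variables of order \<open>\<alpha>\<close> are among the variables
  \<open>y\<close>, to be integrable (\<open>section_integrable_all\<close>). This is assumed only for the whole box, and for
  the derivatives that have order \<open>\<alpha>\<close> in some variable. If some order is \<open>\<alpha>\<close>, sections are
  reached from the whole box by fixing one variable at a time: the expansion with \<open>n = 1\<close> writes the value at \<open>x j\<close> as an integral over the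
  variable \<open>j\<close>. If no order is \<open>\<alpha>\<close>, the sections are built up from a point, one variable
  at a time, as antiderivatives of derivatives of the next order.
\<close>

section \<open>Absolutely continuous functions and the fundamental theorem of calculus\<close>

lemma abs_cont_onE:
  assumes "abs_cont_on l r g" "\<epsilon> > 0"
  obtains \<delta> where "\<delta> > 0" and "\<And>D. \<lbrakk>finite D; \<forall>(s, t)\<in>D. l \<le> s \<and> s \<le> t \<and> t \<le> r;
      disjoint_family_on (\<lambda>(s, t). {s<..<t}) D; (\<Sum>(s, t)\<in>D. t - s) < \<delta>\<rbrakk>
      \<Longrightarrow> (\<Sum>(s, t)\<in>D. \<bar>g t - g s\<bar>) < \<epsilon>"
proof -
  have "\<epsilon> > 0 \<longrightarrow> (\<exists>\<delta>>0. \<forall>D. finite D \<and> (\<forall>(s, t)\<in>D. l \<le> s \<and> s \<le> t \<and> t \<le> r) \<and>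
        disjoint_family_on (\<lambda>(s, t). {s<..<t}) D \<and> (\<Sum>(s, t)\<in>D. t - s) < \<delta>
        \<longrightarrow> (\<Sum>(s, t)\<in>D. \<bar>g t - g s\<bar>) < \<epsilon>)"
    using assms(1) unfolding abs_cont_on_def by (rule spec)
  then obtain \<delta> where "\<delta> > 0" and "\<forall>D. finite D \<and> (\<forall>(s, t)\<in>D. l \<le> s \<and> s \<le> t \<and> t \<le> r) \<and>
        disjoint_family_on (\<lambda>(s, t). {s<..<t}) D \<and> (\<Sum>(s, t)\<in>D. t - s) < \<delta>
        \<longrightarrow> (\<Sum>(s, t)\<in>D. \<bar>g t - g s\<bar>) < \<epsilon>"
    using assms(2) by blast
  then show ?thesis by (intro that[of \<delta>]) blast+
qed

lemma abs_cont_on_subinterval: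
  assumes "abs_cont_on l r g" "l \<le> l'" "r' \<le> r"
  shows "abs_cont_on l' r' g"
  unfolding abs_cont_on_def
proof (intro allI impI)
  fix \<epsilon> :: real assume "\<epsilon> > 0"
  obtain \<delta> where "\<delta> > 0" and \<delta>: "\<And>D. \<lbrakk>finite D; \<forall>(s, t)\<in>D. l \<le> s \<and> s \<le> t \<and> t \<le> r;
      disjoint_family_on (\<lambda>(s, t). {s<..<t}) D; (\<Sum>(s, t)\<in>D. t - s) < \<delta>\<rbrakk>
      \<Longrightarrow> (\<Sum>(s, t)\<in>D. \<bar>g t - g s\<bar>) < \<epsilon>"
    by (rule abs_cont_onE[OF assms(1) \<open>\<epsilon> > 0\<close>]) (rule that, assumption, blast)
  show "\<exists>\<delta>>0. \<forall>D. finite D \<and> (\<forall>(s, t)\<in>D. l' \<le> s \<and> s \<le> t \<and> t \<le> r') \<and>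
        disjoint_family_on (\<lambda>(s, t). {s<..<t}) D \<and> (\<Sum>(s, t)\<in>D. t - s) < \<delta>
        \<longrightarrow> (\<Sum>(s, t)\<in>D. \<bar>g t - g s\<bar>) < \<epsilon>"
  proof (intro exI[of _ \<delta>] conjI \<open>\<delta> > 0\<close> allI impI)
    fix D assume D: "finite D \<and> (\<forall>(s, t)\<in>D. l' \<le> s \<and> s \<le> t \<and> t \<le> r') \<and>
        disjoint_family_on (\<lambda>(s, t). {s<..<t}) D \<and> (\<Sum>(s, t)\<in>D. t - s) < \<delta>"
    then show "(\<Sum>(s, t)\<in>D. \<bar>g t - g s\<bar>) < \<epsilon>"
      using assms(2,3) by (intro \<delta>) fastforce+
  qed
qed

lemma abs_cont_on_imp_continuous_on:
  assumes "abs_cont_on l r g"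
  shows "continuous_on {l..r} g"
  unfolding continuous_on_iff
proof (intro ballI allI impI)
  fix x \<epsilon> :: real assume x: "x \<in> {l..r}" and "\<epsilon> > 0"
  obtain \<delta> where "\<delta> > 0" and \<delta>: "\<And>D. \<lbrakk>finite D; \<forall>(s, t)\<in>D. l \<le> s \<and> s \<le> t \<and> t \<le> r;
      disjoint_family_on (\<lambda>(s, t). {s<..<t}) D; (\<Sum>(s, t)\<in>D. t - s) < \<delta>\<rbrakk>
      \<Longrightarrow> (\<Sum>(s, t)\<in>D. \<bar>g t - g s\<bar>) < \<epsilon>"
    by (rule abs_cont_onE[OF assms(1) \<open>\<epsilon> > 0\<close>]) (rule that, assumption, blast)
  have "dist (g y) (g x) < \<epsilon>" if "y \<in> {l..r}" "dist y x < \<delta>" for y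
    using \<delta>[of "{(min x y, max x y)}"] that x
    by (auto simp: disjoint_family_on_def dist_real_def min_def max_def abs_if split: if_splits)
  then show "\<exists>d>0. \<forall>x'\<in>{l..r}. dist x' x < d \<longrightarrow> dist (g x') (g x) < \<epsilon>"
    using \<open>\<delta> > 0\<close> by blast
qed

lemma abs_cont_on_mult_lipschitz:
  fixes q g :: "real \<Rightarrow> real"
  assumes g: "abs_cont_on l r g"
    and q: "\<And>s t. s \<in> {l..r} \<Longrightarrow> t \<in> {l..r} \<Longrightarrow> \<bar>q t - q s\<bar> \<le> L * \<bar>t - s\<bar>"
    and qb: "\<And>t. t \<in> {l..r} \<Longrightarrow> \<bar>q t\<bar> \<le> M"
  shows "abs_cont_on l r (\<lambda>t. q t * g t)"
  unfolding abs_cont_on_def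
proof (intro allI impI)
  fix \<epsilon> :: real assume "\<epsilon> > 0"
  have "compact (g ` {l..r})"
    by (intro compact_continuous_image abs_cont_on_imp_continuous_on g) auto
  then obtain B where B: "B > 0" "\<And>t. t \<in> {l..r} \<Longrightarrow> \<bar>g t\<bar> \<le> B"
    using compact_imp_bounded bounded_pos by (metis imageI real_norm_def)
  define M' where "M' = \<bar>M\<bar> + 1"
  define L' where "L' = \<bar>L\<bar> + 1"
  have M': "M' > 0" "\<And>t. t \<in> {l..r} \<Longrightarrow> \<bar>q t\<bar> \<le> M'"
    using qb by (force simp: M'_def)+
  have L'0: "L' > 0" by (simp add: L'_def add_nonneg_pos)
  have L': "\<bar>q t - q s\<bar> \<le> L' * \<bar>t - s\<bar>" if "s \<in> {l..r}" "t \<in> {l..r}" for s t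
  proof -
    have "L * \<bar>t - s\<bar> \<le> L' * \<bar>t - s\<bar>"
      by (intro mult_right_mono) (auto simp: L'_def)
    then show ?thesis using q[OF that] by linarith
  qed
  have \<epsilon>': "\<epsilon> / (2 * M') > 0" using \<open>\<epsilon> > 0\<close> M' by simp
  obtain \<delta> where "\<delta> > 0" and \<delta>: "\<And>D. \<lbrakk>finite D; \<forall>(s, t)\<in>D. l \<le> s \<and> s \<le> t \<and> t \<le> r;
      disjoint_family_on (\<lambda>(s, t). {s<..<t}) D; (\<Sum>(s, t)\<in>D. t - s) < \<delta>\<rbrakk>
      \<Longrightarrow> (\<Sum>(s, t)\<in>D. \<bar>g t - g s\<bar>) < \<epsilon> / (2 * M')"
    by (rule abs_cont_onE[OF g \<epsilon>']) (rule that, assumption, blast)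
  show "\<exists>\<delta>>0. \<forall>D. finite D \<and> (\<forall>(s, t)\<in>D. l \<le> s \<and> s \<le> t \<and> t \<le> r) \<and>
        disjoint_family_on (\<lambda>(s, t). {s<..<t}) D \<and> (\<Sum>(s, t)\<in>D. t - s) < \<delta>
        \<longrightarrow> (\<Sum>(s, t)\<in>D. \<bar>q t * g t - q s * g s\<bar>) < \<epsilon>"
  proof (intro exI[of _ "min \<delta> (\<epsilon> / (2 * B * L'))"] conjI allI impI)
    show "0 < min \<delta> (\<epsilon> / (2 * B * L'))"
      using \<open>\<delta> > 0\<close> \<open>\<epsilon> > 0\<close> B L'0 by simp
    fix D assume D: "finite D \<and> (\<forall>(s, t)\<in>D. l \<le> s \<and> s \<le> t \<and> t \<le> r) \<and>
        disjoint_family_on (\<lambda>(s, t). {s<..<t}) D \<and> (\<Sum>(s, t)\<in>D. t - s) < min \<delta> (\<epsilon> / (2 * B * L'))"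
    have "(\<Sum>(s, t)\<in>D. \<bar>q t * g t - q s * g s\<bar>)
        \<le> (\<Sum>(s, t)\<in>D. M' * \<bar>g t - g s\<bar> + B * L' * (t - s))"
    proof (intro sum_mono, clarify)
      fix s t assume "(s, t) \<in> D"
      then have st: "l \<le> s" "s \<le> t" "t \<le> r" using D by auto
      have "\<bar>q t * g t - q s * g s\<bar> = \<bar>q t * (g t - g s) + g s * (q t - q s)\<bar>"
        by (simp add: algebra_simps)
      also have "\<dots> \<le> \<bar>q t\<bar> * \<bar>g t - g s\<bar> + \<bar>g s\<bar> * \<bar>q t - q s\<bar>"
        using abs_triangle_ineq[of "q t * (g t - g s)" "g s * (q t - q s)"] by (simp add: abs_mult)
      also have "\<dots> \<le> M' * \<bar>g t - g s\<bar> + B * (L' * \<bar>t - s\<bar>)"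
        using st M' L'[of s t] B by (intro add_mono mult_mono) auto
      finally show "\<bar>q t * g t - q s * g s\<bar> \<le> M' * \<bar>g t - g s\<bar> + B * L' * (t - s)"
        using st by simp
    qed
    also have "\<dots> = M' * (\<Sum>(s, t)\<in>D. \<bar>g t - g s\<bar>) + B * L' * (\<Sum>(s, t)\<in>D. t - s)"
      by (simp add: sum.distrib case_prod_unfold sum_distrib_left)
    also have "\<dots> < M' * (\<epsilon> / (2 * M')) + B * L' * (\<epsilon> / (2 * B * L'))"
      using D B L'0 M' by (intro add_strict_mono mult_strict_left_mono \<delta>) auto
    also have "\<dots> = \<epsilon>"
      using B L'0 M' by (simp add: field_simps)
    finally show "(\<Sum>(s, t)\<in>D. \<bar>q t * g t - q s * g s\<bar>) < \<epsilon>" .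
  qed
qed

text \<open>
  No integrability of \<open>h\<close> has to be assumed, because the Henstock-Kurzweil integral is used: the
  gauge is given by the derivative outside the exceptional null set \<open>N\<close>. On \<open>N\<close> it is an open
  set \<open>T \<supseteq> N\<close> of small measure, so that absolute continuity bounds the increments of \<open>g\<close> over
  all the intervals whose tags are in \<open>N\<close>.
\<close>

theorem abs_cont_fundamental_theorem:
  assumes lr: "l \<le> r" and ac: "abs_cont_on l r g"
    and der: "AE t in lebesgue. t \<in> {l..r} \<longrightarrow> (g has_vector_derivative h t) (at t within {l..r})"
  shows "(h has_integral (g r - g l)) {l..r}"
proof -
  obtain N where N: "N \<in> null_sets lebesgue"
    and Nd: "\<And>t. t \<in> {l..r} \<Longrightarrow> t \<notin> N \<Longrightarrow> (g has_vector_derivative h t) (at t within {l..r})"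
  proof -
    from der show thesis by (rule AE_E3) (rule that, auto)
  qed
  define h0 where "h0 t = (if t \<in> N then 0 else h t)" for t
  have "(h0 has_integral (g r - g l)) (cbox l r)"
    unfolding has_integral
  proof (intro allI impI)
    fix e :: real assume e: "e > 0"
    define c where "c = e / (2 * (r - l + 1))"
    have c: "c > 0" "c * (r - l) < e / 2"
      using e lr by (auto simp: c_def field_simps)
    obtain \<delta> where "\<delta> > 0" and \<delta>: "\<And>D. \<lbrakk>finite D; \<forall>(s, t)\<in>D. l \<le> s \<and> s \<le> t \<and> t \<le> r;
        disjoint_family_on (\<lambda>(s, t). {s<..<t}) D; (\<Sum>(s, t)\<in>D. t - s) < \<delta>\<rbrakk>
        \<Longrightarrow> (\<Sum>(s, t)\<in>D. \<bar>g t - g s\<bar>) < e / 2"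
      by (rule abs_cont_onE[OF ac half_gt_zero[OF e]]) (rule that, assumption, blast)
    obtain T where T: "open T" "N \<subseteq> T" "T - N \<in> lmeasurable" "emeasure lebesgue (T - N) < ennreal \<delta>"
      using sets_lebesgue_outer_open[of N \<delta>] N \<open>\<delta> > 0\<close> by blast
    have TN: "T = (T - N) \<union> N" using T by blast
    have "emeasure lebesgue T = emeasure lebesgue (T - N)"
      using N T by (subst TN, subst emeasure_Un_null_set) auto
    then have Tl: "emeasure lebesgue T < ennreal \<delta>" using T(4) by simp
    then have "emeasure lebesgue T < \<infinity>"
      using ennreal_less_top order.strict_trans by (metis infinity_ennreal_def)
    then have Tm: "T \<in> lmeasurable"
      using T(1) by (intro fmeasurableI) auto
    then have Tm2: "measure lebesgue T < \<delta>"
      using Tl \<open>\<delta> > 0\<close> by (simp add: emeasure_eq_measure2 ennreal_less_iff)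
    have "\<forall>x. \<exists>d>0. x \<in> {l..r} - N \<longrightarrow>
         (\<forall>y\<in>{l..r}. norm (y-x) < d \<longrightarrow> norm (g y - g x - (y-x) *\<^sub>R h x) \<le> c * norm (y-x))"
      using Nd[unfolded has_vector_derivative_def has_derivative_within_alt] \<open>c > 0\<close> by blast
    then obtain d where d: "\<And>x. 0 < d x"
        "\<And>x y. \<lbrakk>x \<in> {l..r} - N; y \<in> {l..r}; norm (y-x) < d x\<rbrakk>
                        \<Longrightarrow> norm (g y - g x - (y-x) *\<^sub>R h x) \<le> c * norm (y-x)"
      by metis
    define \<gamma> where "\<gamma> x = (if x \<in> N then T else ball x (d x))" for x
    have "norm ((\<Sum>(x, K)\<in>p. measure lborel K *\<^sub>R h0 x) - (g r - g l)) < e"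
      if p: "p tagged_division_of cbox l r" and fine: "\<gamma> fine p" for p
    proof -
      have finp: "finite p" using p by blast
      have K: "\<exists>u v. K = {u..v} \<and> l \<le> u \<and> u \<le> v \<and> v \<le> r \<and> x \<in> {u..v}" if xK: "(x, K) \<in> p" for x K
      proof -
        obtain u v where "K = cbox u v" "x \<in> K" "K \<subseteq> cbox l r"
          using tagged_division_ofD(2)[OF p xK] tagged_division_ofD(3)[OF p xK]
            tagged_division_ofD(4)[OF p xK] by blast
        then show ?thesis by (intro exI[of _ u] exI[of _ v]) auto
      qed
      \<comment> \<open>the intervals with exceptional tags, and the others\<close>
      define p1 where "p1 = {(x, K) \<in> p. x \<in> N}"
      define p2 where "p2 = {(x, K) \<in> p. x \<notin> N}"
      have pp: "p = p1 \<union> p2" "p1 \<inter> p2 = {}" "finite p1" "finite p2" 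
        using finp by (auto simp: p1_def p2_def intro: finite_subset[OF _ finp])
      have tel: "r - l = (\<Sum>(x,K)\<in>p. Sup K - Inf K)" "g r - g l = (\<Sum>(x,K)\<in>p. g(Sup K) - g(Inf K))"
        using additive_tagged_division_1[where f= "\<lambda>x. x"] additive_tagged_division_1[where f=g] lr p
        by auto
      let ?D = "\<lambda>(x, K). measure lborel K *\<^sub>R h0 x - (g (Sup K) - g (Inf K))"
      have s2: "norm (\<Sum>z\<in>p2. ?D z) \<le> (\<Sum>(x,K)\<in>p2. c * (Sup K - Inf K))"
      proof (rule sum_norm_le, clarify)
        fix x K assume xK: "(x, K) \<in> p2"
        then obtain u v where uv: "K = {u..v}" "l \<le> u" "u \<le> v" "v \<le> r" "x \<in> {u..v}"
          using K pp by blast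
        have xN: "(x, K) \<in> p" "x \<notin> N" using xK by (auto simp: p2_def)
        moreover have "K \<subseteq> \<gamma> x" using fineD[OF fine xN(1)] .
        ultimately have "K \<subseteq> ball x (d x)" "x \<notin> N" by (auto simp: \<gamma>_def)
        then have "u \<in> ball x (d x)" "v \<in> ball x (d x)" using uv(1,3) by auto
        then have b: "\<bar>u - x\<bar> < d x" "\<bar>v - x\<bar> < d x"
          by (simp_all add: dist_real_def abs_minus_commute)
        have "norm (g u - g x - (u - x) *\<^sub>R h x) \<le> c * norm (u - x)"
          "norm (g v - g x - (v - x) *\<^sub>R h x) \<le> c * norm (v - x)"
          by (rule d(2); use uv b \<open>x \<notin> N\<close> in simp)+
        then have "\<bar>(v - u) * h x - (g v - g u)\<bar> \<le> c * (x - u) + c * (v - x)"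
          using uv by (simp add: algebra_simps abs_if split: if_splits)
        then show "norm (measure lborel K *\<^sub>R h0 x - (g (Sup K) - g (Inf K))) \<le> c * (Sup K - Inf K)"
          using uv \<open>x \<notin> N\<close> by (simp add: h0_def algebra_simps)
      qed
      also have "\<dots> \<le> (\<Sum>(x,K)\<in>p. c * (Sup K - Inf K))"
      proof (rule sum_mono2[OF finp])
        show "p2 \<subseteq> p" using pp(1) by blast
        fix z assume "z \<in> p - p2"
        then show "0 \<le> (case z of (x, K) \<Rightarrow> c * (Sup K - Inf K))"
          using K[of "fst z" "snd z"] c(1) by (auto simp: case_prod_unfold)
      qed
      also have "\<dots> = c * (r - l)"
        by (simp add: tel(1) sum_distrib_left case_prod_unfold)
      finally have s2': "norm (\<Sum>z\<in>p2. ?D z) < e / 2" using c by simp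
      let ?I = "\<lambda>(x::real, K::real set). (Inf K, Sup K)"
      have disj: "interior K \<inter> interior K' = {}" if "(x, K) \<in> p" "(x', K') \<in> p" "(x, K) \<noteq> (x', K')" for x K x' K'
        by (rule tagged_division_ofD(5)[OF p that])
      \<comment> \<open>absolute continuity is stated for sets of pairs, so no interval may occur with two tags\<close>
      have inj: "inj_on ?I p1"
      proof (rule inj_onI, clarify)
        fix x K x' K' assume as: "(x, K) \<in> p1" "(x', K') \<in> p1" "Inf K = Inf K'" "Sup K = Sup K'"
        then have as': "(x, K) \<in> p" "(x', K') \<in> p" by (auto simp: p1_def)
        obtain u v u' v' where uv: "K = {u..v}" "u \<le> v" "x \<in> {u..v}" "K' = {u'..v'}" "u' \<le> v'" "x' \<in> {u'..v'}"
          using K[OF as'(1)] K[OF as'(2)] by blast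
        then have eq: "u = u'" "v = v'" using as by auto
        show "x = x' \<and> K = K'"
        proof (rule ccontr)
          assume "\<not> (x = x' \<and> K = K')"
          then have "interior K \<inter> interior K' = {}" using disj[OF as'] by blast
          then have "u = v" using uv eq by auto
          then show False using uv eq \<open>\<not> (x = x' \<and> K = K')\<close> by auto
        qed
      qed
      have "(\<Sum>(s, t)\<in>?I ` p1. \<bar>g t - g s\<bar>) < e / 2"
      proof (rule \<delta>)
        show "finite (?I ` p1)" using pp by auto
        show "\<forall>(s, t)\<in>?I ` p1. l \<le> s \<and> s \<le> t \<and> t \<le> r"
        proof clarify
          fix x K assume "(x, K) \<in> p1"
          then show "l \<le> Inf K \<and> Inf K \<le> Sup K \<and> Sup K \<le> r"
            using K[of x K] pp(1) by auto
        qed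
        show "disjoint_family_on (\<lambda>(s, t). {s<..<t}) (?I ` p1)"
        proof -
          have *: "{Inf K<..<Sup K} \<inter> {Inf K'<..<Sup K'} = {}"
            if as: "(x, K) \<in> p1" "(x', K') \<in> p1" "(Inf K, Sup K) \<noteq> (Inf K', Sup K')" for x K x' K'
          proof -
            have as': "(x, K) \<in> p" "(x', K') \<in> p" using as by (auto simp: p1_def)
            have "interior K \<inter> interior K' = {}" using disj[OF as'] as(3) by auto
            then show ?thesis using K[OF as'(1)] K[OF as'(2)] by (auto simp: interior_atLeastAtMost_real)
          qed
          show ?thesis unfolding disjoint_family_on_def
          proof (intro ballI impI)
            fix i j assume "i \<in> ?I ` p1" "j \<in> ?I ` p1" "i \<noteq> j"
            then obtain x K x' K' where "(x, K) \<in> p1" "(x', K') \<in> p1"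
              "i = (Inf K, Sup K)" "j = (Inf K', Sup K')" by auto
            then show "(case i of (s, t) \<Rightarrow> {s<..<t}) \<inter> (case j of (s, t) \<Rightarrow> {s<..<t}) = {}"
              using *[of x K x' K'] \<open>i \<noteq> j\<close> by simp
          qed
        qed
        have "(\<Sum>(s, t)\<in>?I ` p1. t - s) = (\<Sum>(x, K)\<in>p1. Sup K - Inf K)"
          using inj by (subst sum.reindex) (auto simp: case_prod_unfold)
        also have "\<dots> = (\<Sum>z\<in>p1. measure lebesgue (snd z))"
        proof (rule sum.cong[OF refl])
          fix z assume "z \<in> p1"
          then show "(case z of (x, K) \<Rightarrow> Sup K - Inf K) = measure lebesgue (snd z)"
            using K[of "fst z" "snd z"] pp(1) by (auto simp: case_prod_unfold)
        qed
        also have "\<dots> = measure lebesgue (\<Union>(snd ` p1))"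
        proof (rule measure_negligible_finite_Union_image[symmetric])
          show "finite p1" by fact
          show "snd z \<in> lmeasurable" if "z \<in> p1" for z
            using that K[of "fst z" "snd z"] pp(1) by (metis Un_iff box_real(2) lmeasurable_cbox prod.collapse)
          show "pairwise (\<lambda>x y. negligible (snd x \<inter> snd y)) p1"
          proof (rule pairwiseI)
            fix z z' assume as: "z \<in> p1" "z' \<in> p1" "z \<noteq> z'"
            then have as': "(fst z, snd z) \<in> p" "(fst z', snd z') \<in> p" by (auto simp: p1_def)
            have "interior (snd z) \<inter> interior (snd z') = {}"
              using disj[OF as'] as(3) by auto
            then have "interior (snd z \<inter> snd z') = {}" by simp
            moreover obtain u v u' v' where "snd z = {u..v}" "snd z' = {u'..v'}"
              using K[OF as'(1)] K[OF as'(2)] by blast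
            then have "snd z \<inter> snd z' = cbox (max u u') (min v v')" by auto
            ultimately show "negligible (snd z \<inter> snd z')"
              by (simp only: negligible_interval interior_cbox)
          qed
        qed
        also have "\<dots> \<le> measure lebesgue T"
        proof (rule measure_mono_fmeasurable)
          show "\<Union>(snd ` p1) \<subseteq> T"
          proof clarify
            fix y x K assume "(x, K) \<in> p1" "y \<in> snd (x, K)"
            then have "(x, K) \<in> p" "x \<in> N" "y \<in> K" by (auto simp: p1_def)
            then show "y \<in> T" using fineD[OF fine, of x K] by (auto simp: \<gamma>_def)
          qed
          show "\<Union>(snd ` p1) \<in> sets lebesgue"
          proof (rule sets.finite_Union)
            show "snd ` p1 \<subseteq> sets lebesgue"
            proof clarify
              fix x K assume "(x, K) \<in> p1"
              then show "snd (x, K) \<in> sets lebesgue" using K[of x K] pp(1) by auto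
            qed
          qed (use pp in auto)
        qed fact
        finally show "(\<Sum>(s, t)\<in>?I ` p1. t - s) < \<delta>" using Tm2 by simp
      qed
      also have "(\<Sum>(s, t)\<in>?I ` p1. \<bar>g t - g s\<bar>) = (\<Sum>(x, K)\<in>p1. \<bar>g (Sup K) - g (Inf K)\<bar>)"
        using inj by (subst sum.reindex) (auto simp: case_prod_unfold)
      finally have s1: "(\<Sum>(x, K)\<in>p1. \<bar>g (Sup K) - g (Inf K)\<bar>) < e / 2" .
      have "norm (\<Sum>z\<in>p1. ?D z) \<le> (\<Sum>(x, K)\<in>p1. \<bar>g (Sup K) - g (Inf K)\<bar>)"
        by (rule sum_norm_le) (auto simp: p1_def h0_def)
      then have s1': "norm (\<Sum>z\<in>p1. ?D z) < e / 2" using s1 by simp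
      have "(\<Sum>(x, K)\<in>p. measure lborel K *\<^sub>R h0 x) - (g r - g l) = (\<Sum>z\<in>p. ?D z)"
        unfolding tel by (simp add: sum_subtractf case_prod_unfold)
      also have "\<dots> = (\<Sum>z\<in>p1. ?D z) + (\<Sum>z\<in>p2. ?D z)"
        using pp by (simp add: sum.union_disjoint)
      finally show ?thesis using s1' s2' norm_triangle_ineq[of "\<Sum>z\<in>p1. ?D z" "\<Sum>z\<in>p2. ?D z"]
        by (smt (verit, best) field_sum_of_halves)
    qed
    moreover have "gauge \<gamma>"
      using T d(1) by (auto simp: gauge_def \<gamma>_def)
    ultimately show "\<exists>\<gamma>. gauge \<gamma> \<and> (\<forall>p. p tagged_division_of cbox l r \<and> \<gamma> fine p \<longrightarrow>
         norm ((\<Sum>(x, K)\<in>p. measure lborel K *\<^sub>R h0 x) - (g r - g l)) < e)"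
      by blast
  qed
  then show ?thesis
    using has_integral_spike[of N "{l..r}" h h0] N
    by (auto simp: h0_def negligible_iff_null_sets)
qed

section \<open>Bernoulli polynomials and the expansion in one variable\<close>

lemma bernoulli_num_sum_zero:
  assumes "2 \<le> n"
  shows "(\<Sum>k<n. real (n choose k) * bernoulli_num k) = 0"
proof -
  obtain m where n: "n = Suc m" "m \<ge> 1" using assms by (cases n) auto
  have "bernoulli_num m = - (\<Sum>k<m. real (Suc m choose k) * bernoulli_num k) / real (Suc m)"
    using n by (subst bernoulli_num.simps) simp
  then show ?thesis unfolding n by (simp add: field_simps)
qed

lemma bernoulli_poly_0: "bernoulli_poly 0 x = 1"
  by (simp add: bernoulli_poly_def bernoulli_num.simps)

lemma bernoulli_poly_at_0: "bernoulli_poly n 0 = bernoulli_num n"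
proof -
  have "bernoulli_poly n 0 = (\<Sum>k\<le>n. if k = n then bernoulli_num n else 0)"
    unfolding bernoulli_poly_def by (rule sum.cong) (auto simp: power_0_left)
  then show ?thesis by simp
qed

lemma bernoulli_poly_at_1: "bernoulli_poly n 1 = bernoulli_num n + (if n = 1 then 1 else 0)"
proof -
  have "bernoulli_poly n 1 = (\<Sum>k<n. real (n choose k) * bernoulli_num k) + bernoulli_num n"
    by (simp add: bernoulli_poly_def lessThan_Suc_atMost[symmetric])
  moreover have "(\<Sum>k<n. real (n choose k) * bernoulli_num k) = (if n = 1 then 1 else 0)"
  proof (cases "n \<ge> 2")
    case False
    then have "n = 0 \<or> n = 1" by auto
    then show ?thesis by (auto simp: bernoulli_num.simps)
  qed (use bernoulli_num_sum_zero in auto)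
  ultimately show ?thesis by simp
qed

lemma bernoulli_poly_has_field_derivative:
  "(bernoulli_poly (Suc n) has_field_derivative real (Suc n) * bernoulli_poly n x) (at x within S)"
proof -
  have *: "real (Suc n choose k) * bernoulli_num k * (real (Suc n - k) * x ^ (n - k)) =
     real (Suc n) * (real (n choose k) * bernoulli_num k * x ^ (n - k))" if "k \<le> n" for k
  proof -
    have "(Suc n - k) * (Suc n choose k) = Suc n * (n choose k)"
      using that binomial_absorb_comp[of "Suc n" k] by simp
    then have "real (Suc n - k) * real (Suc n choose k) = real (Suc n) * real (n choose k)"
      by (metis of_nat_mult)
    then show ?thesis by (simp add: algebra_simps del: of_nat_Suc binomial_Suc_Suc)
  qed
  have "((\<lambda>x. \<Sum>k\<le>Suc n. real (Suc n choose k) * bernoulli_num k * x ^ (Suc n - k)) has_field_derivative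
      (\<Sum>k\<le>Suc n. real (Suc n choose k) * bernoulli_num k * (real (Suc n - k) * x ^ (Suc n - k - Suc 0)))) (at x within S)"
    by (rule DERIV_sum) (auto intro!: derivative_eq_intros)
  also have "(\<Sum>k\<le>Suc n. real (Suc n choose k) * bernoulli_num k * (real (Suc n - k) * x ^ (Suc n - k - Suc 0)))
      = real (Suc n) * bernoulli_poly n x"
  proof -
    have "(\<Sum>k\<le>n. real (Suc n choose k) * bernoulli_num k * (real (Suc n - k) * x ^ (n - k))) =
        (\<Sum>k\<le>n. real (Suc n) * (real (n choose k) * bernoulli_num k * x ^ (n - k)))"
      by (rule sum.cong[OF refl], rule *) simp
    then show ?thesis
      by (simp add: bernoulli_poly_def sum_distrib_left del: of_nat_Suc binomial_Suc_Suc of_nat_diff)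
  qed
  finally show ?thesis by (simp add: bernoulli_poly_def[abs_def])
qed

lemma scaled_bernoulli_0: "scaled_bernoulli l r 0 x = 1 / (r - l)"
  by (simp add: scaled_bernoulli_def bernoulli_poly_0 power_int_minus field_simps)

lemma scaled_bernoulli_has_field_derivative:
  assumes "l < r"
  shows "(scaled_bernoulli l r (Suc n) has_field_derivative real (Suc n) * scaled_bernoulli l r n x) (at x within S)"
proof -
  have "((\<lambda>x. bernoulli_poly (Suc n) ((x - l) / (r - l))) has_field_derivative
     real (Suc n) * bernoulli_poly n ((x - l) / (r - l)) * (1 / (r - l))) (at x within S)"
    by (rule DERIV_chain2[OF bernoulli_poly_has_field_derivative[where S=UNIV]])
      (use assms in \<open>auto intro!: derivative_eq_intros\<close>)
  from DERIV_cmult[OF this, of "(r - l) powi (int (Suc n) - 1)"]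
  have "(scaled_bernoulli l r (Suc n) has_field_derivative (r - l) powi (int (Suc n) - 1) *
      (real (Suc n) * bernoulli_poly n ((x - l) / (r - l)) * (1 / (r - l)))) (at x within S)"
    by (simp add: scaled_bernoulli_def[abs_def])
  also have "(r - l) powi (int (Suc n) - 1) * (real (Suc n) * bernoulli_poly n ((x - l) / (r - l)) * (1 / (r - l)))
     = real (Suc n) * scaled_bernoulli l r n x"
    using assms by (simp add: scaled_bernoulli_def power_int_diff)
  finally show ?thesis .
qed

lemma scaled_bernoulli_endpoints:
  assumes "l < r"
  shows "scaled_bernoulli l r n r = scaled_bernoulli l r n l + (if n = 1 then 1 else 0)"
  using assms by (auto simp: scaled_bernoulli_def bernoulli_poly_at_0 bernoulli_poly_at_1)

lemma continuous_on_scaled_bernoulli [continuous_intros]: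
  assumes "l < r" "continuous_on S f"
  shows "continuous_on S (\<lambda>x. scaled_bernoulli l r n (f x))"
  using assms unfolding scaled_bernoulli_def bernoulli_poly_def
  by (intro continuous_intros) auto

lemma periodic_bernoulli_bounded:
  assumes "l < r"
  obtains B where "\<And>x. \<bar>periodic_bernoulli l r n x\<bar> \<le> B"
proof -
  have "compact (scaled_bernoulli l r n ` {l..r})"
    using continuous_on_scaled_bernoulli[OF assms continuous_on_id]
    by (intro compact_continuous_image) (auto simp: id_def)
  then obtain B where B: "\<And>x. x \<in> {l..r} \<Longrightarrow> \<bar>scaled_bernoulli l r n x\<bar> \<le> B"
    using compact_imp_bounded bounded_iff by (metis imageI real_norm_def)
  have "l + (r - l) * frac y \<in> {l..r}" for y
  proof -
    have "(r - l) * frac y \<le> r - l" "0 \<le> (r - l) * frac y"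
      using assms frac_lt_1[of y] by (auto intro!: mult_left_le)
    then show ?thesis by simp
  qed
  then show ?thesis
    by (intro that[of B]) (auto simp: periodic_bernoulli_def intro!: B)
qed

lemma measurable_periodic_bernoulli [measurable]: "periodic_bernoulli l r n \<in> borel_measurable borel"
  unfolding periodic_bernoulli_def[abs_def] scaled_bernoulli_def bernoulli_poly_def frac_def
  by measurable

lemma periodic_bernoulli_eq:
  assumes "l < r" "l \<le> x" "x < r"
  shows "periodic_bernoulli l r n x = scaled_bernoulli l r n x"
proof -
  have "frac ((x - l) / (r - l)) = (x - l) / (r - l)"
    using assms by (subst frac_eq) (auto simp: field_simps)
  then show ?thesis using assms by (simp add: periodic_bernoulli_def)
qed

lemma periodic_bernoulli_eq_shift:
  assumes "l < r" "l \<le> x + (r - l)" "x < l"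
  shows "periodic_bernoulli l r n x = scaled_bernoulli l r n (x + (r - l))"
proof -
  have "frac ((x - l) / (r - l)) = frac ((x - l) / (r - l) + 1)" by (simp add: frac_1_eq)
  also have "(x - l) / (r - l) + 1 = (x + (r - l) - l) / (r - l)"
    using assms by (simp add: field_simps)
  finally show ?thesis
    using periodic_bernoulli_eq[of l r "x + (r - l)" n] assms by (simp add: periodic_bernoulli_def)
qed

text \<open>
  The product with a continuously differentiable function stays absolutely continuous. Again
  \<open>h\<close> need not be Lebesgue integrable.
\<close>

lemma abs_cont_integration_by_parts:
  fixes q q' g h :: "real \<Rightarrow> real"
  assumes lr: "l \<le> r" and ac: "abs_cont_on l r g"
    and der: "AE t in lebesgue. t \<in> {l..r} \<longrightarrow> (g has_vector_derivative h t) (at t within {l..r})"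
    and q: "\<And>t. t \<in> {l..r} \<Longrightarrow> (q has_field_derivative q' t) (at t within {l..r})"
    and q': "continuous_on {l..r} q'"
  shows "((\<lambda>t. q t * h t) has_integral (q r * g r - q l * g l - integral {l..r} (\<lambda>t. q' t * g t))) {l..r}"
proof -
  have cq: "continuous_on {l..r} q"
    using q by (metis DERIV_continuous_on)
  have "bounded (q ` {l..r})" "bounded (q' ` {l..r})"
    by (intro compact_imp_bounded compact_continuous_image cq q' compact_Icc)+
  then obtain M L where M: "\<And>t. t \<in> {l..r} \<Longrightarrow> \<bar>q t\<bar> \<le> M" and L: "\<And>t. t \<in> {l..r} \<Longrightarrow> \<bar>q' t\<bar> \<le> L"
    unfolding bounded_iff real_norm_def by (meson imageI)
  have "\<bar>q t - q s\<bar> \<le> L * \<bar>t - s\<bar>" if "s \<in> {l..r}" "t \<in> {l..r}" for s t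
    using field_differentiable_bound[of "{l..r}" q q' L t s] q L that by auto
  then have "abs_cont_on l r (\<lambda>t. q t * g t)"
    by (rule abs_cont_on_mult_lipschitz[OF ac _ M])
  moreover have "AE t in lebesgue. t \<in> {l..r} \<longrightarrow>
      ((\<lambda>t. q t * g t) has_vector_derivative (q t * h t + q' t * g t)) (at t within {l..r})"
    using der
  proof eventually_elim
    case (elim t)
    show ?case
    proof
      assume t: "t \<in> {l..r}"
      show "((\<lambda>t. q t * g t) has_vector_derivative (q t * h t + q' t * g t)) (at t within {l..r})"
        using has_vector_derivative_mult[OF _ elim[rule_format, OF t], of q "q' t"] q[OF t]
        by (simp add: has_real_derivative_iff_has_vector_derivative)
    qed
  qed
  ultimately have 1: "((\<lambda>t. q t * h t + q' t * g t) has_integral (q r * g r - q l * g l)) {l..r}"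
    by (rule abs_cont_fundamental_theorem[OF lr])
  have "continuous_on {l..r} (\<lambda>t. q' t * g t)"
    by (intro continuous_intros q' abs_cont_on_imp_continuous_on ac)
  then have "((\<lambda>t. q' t * g t) has_integral integral {l..r} (\<lambda>t. q' t * g t)) {l..r}"
    by (intro integrable_integral integrable_continuous_interval)
  from has_integral_diff[OF 1 this] show ?thesis by simp
qed

text \<open>
  The remainder integral of order \<open>n\<close>, without its sign, for a function \<open>g\<close> which plays the role of
  the \<open>n\<close>-th derivative.
\<close>

definition bernoulli_remainder :: "real \<Rightarrow> real \<Rightarrow> nat \<Rightarrow> (real \<Rightarrow> real) \<Rightarrow> real \<Rightarrow> real" where
  "bernoulli_remainder l r n g x =
     integral {l..r} (\<lambda>y. periodic_bernoulli l r n (x - y + l) / fact n * g y)"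

text \<open>
  The argument \<open>x - y + l\<close> is in the basic period for \<open>y \<le> x\<close>, and one period below it for \<open>y > x\<close>.
  The pointwise equalities may fail at an end point of the two intervals, which the integrals ignore.
\<close>

lemma has_integral_periodic_bernoulli:
  assumes lr: "l < r" and x: "x \<in> {l..r}"
    and 1: "((\<lambda>y. scaled_bernoulli l r n (x - y + l) * g y) has_integral i) {l..x}"
    and 2: "((\<lambda>y. scaled_bernoulli l r n (x - y + r) * g y) has_integral j) {x..r}"
  shows "((\<lambda>y. periodic_bernoulli l r n (x - y + l) / fact n * g y) has_integral ((i + j) / fact n)) {l..r}"
proof -
  have "((\<lambda>y. periodic_bernoulli l r n (x - y + l) * g y) has_integral i) {l..x}"
    using _ _ 1
  proof (rule has_integral_spike_finite[of "{l}"])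
    fix y assume "y \<in> {l..x} - {l}"
    then show "periodic_bernoulli l r n (x - y + l) * g y = scaled_bernoulli l r n (x - y + l) * g y"
      using x lr by (subst periodic_bernoulli_eq) auto
  qed auto
  moreover have "((\<lambda>y. periodic_bernoulli l r n (x - y + l) * g y) has_integral j) {x..r}"
    using _ _ 2
  proof (rule has_integral_spike_finite[of "{x}"])
    fix y assume "y \<in> {x..r} - {x}"
    then show "periodic_bernoulli l r n (x - y + l) * g y = scaled_bernoulli l r n (x - y + r) * g y"
      using x lr by (subst periodic_bernoulli_eq_shift) (auto simp: algebra_simps)
  qed auto
  ultimately have "((\<lambda>y. periodic_bernoulli l r n (x - y + l) * g y) has_integral (i + j)) {l..r}"
    using x by (intro has_integral_combine[of l x r]) auto
  from has_integral_divide[OF this, of "fact n"] show ?thesis by simp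
qed

text \<open>
  Integration by parts on \<open>[l, x]\<close> and on \<open>[x, r]\<close>. The boundary terms at \<open>x\<close> combine to
  \<open>(B (Suc n) l - B (Suc n) r) * g x\<close>, which vanishes unless \<open>n = 0\<close>.
\<close>

lemma bernoulli_remainder_step:
  assumes lr: "l < r" and x: "x \<in> {l..r}"
    and ac: "abs_cont_on l r g"
    and der: "AE t in lebesgue. t \<in> {l..r} \<longrightarrow> (g has_vector_derivative h t) (at t within {l..r})"
  shows "bernoulli_remainder l r (Suc n) h x =
     scaled_bernoulli l r (Suc n) x / fact (Suc n) * integral {l..r} h
       + bernoulli_remainder l r n g x - (if n = 0 then g x else 0)"
proof -
  let ?B = "scaled_bernoulli l r"
  have cg: "continuous_on {l..r} g" by (rule abs_cont_on_imp_continuous_on[OF ac])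
  have parts: "((\<lambda>t. ?B (Suc n) (c - t) * h t) has_integral
      (?B (Suc n) (c - v) * g v - ?B (Suc n) (c - u) * g u
        + real (Suc n) * integral {u..v} (\<lambda>t. ?B n (c - t) * g t))) {u..v}"
    if uv: "l \<le> u" "u \<le> v" "v \<le> r" for u v c
  proof -
    have "((\<lambda>t. ?B (Suc n) (c - t) * h t) has_integral (?B (Suc n) (c - v) * g v - ?B (Suc n) (c - u) * g u
        - integral {u..v} (\<lambda>t. - real (Suc n) * ?B n (c - t) * g t))) {u..v}"
    proof (rule abs_cont_integration_by_parts)
      show "abs_cont_on u v g" by (rule abs_cont_on_subinterval[OF ac]) (use uv in auto)
      show "AE t in lebesgue. t \<in> {u..v} \<longrightarrow> (g has_vector_derivative h t) (at t within {u..v})"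
        using der
      proof eventually_elim
        case (elim t)
        then show ?case using uv by (auto intro: has_vector_derivative_within_subset)
      qed
      fix t
      have "((\<lambda>t. ?B (Suc n) (c - t)) has_field_derivative
          real (Suc n) * ?B n (c - t) * (-1)) (at t within {u..v})"
        by (rule DERIV_chain2[OF scaled_bernoulli_has_field_derivative[OF lr, where S=UNIV]])
          (auto intro!: derivative_eq_intros)
      then show "((\<lambda>t. ?B (Suc n) (c - t)) has_field_derivative - real (Suc n) * ?B n (c - t)) (at t within {u..v})"
        by (simp del: of_nat_Suc)
    qed (use uv lr in \<open>auto intro!: continuous_intros\<close>)
    moreover have "integral {u..v} (\<lambda>t. - real (Suc n) * ?B n (c - t) * g t)
        = - real (Suc n) * integral {u..v} (\<lambda>t. ?B n (c - t) * g t)"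
      unfolding mult.assoc by (rule integral_mult_right)
    ultimately show ?thesis by (simp del: of_nat_Suc)
  qed
  define I where "I = integral {l..x} (\<lambda>t. ?B n (x + l - t) * g t)"
  define J where "J = integral {x..r} (\<lambda>t. ?B n (x + r - t) * g t)"
  have eqs: "x - y + l = x + l - y" "x - y + r = x + r - y" for y by simp_all
  have "((\<lambda>t. ?B n (x - t + l) * g t) has_integral I) {l..x}"
    unfolding I_def eqs using x lr
    by (intro integrable_integral integrable_continuous_interval continuous_intros continuous_on_subset[OF cg]) auto
  moreover have "((\<lambda>t. ?B n (x - t + r) * g t) has_integral J) {x..r}"
    unfolding J_def eqs using x lr
    by (intro integrable_integral integrable_continuous_interval continuous_intros continuous_on_subset[OF cg]) auto
  ultimately have Rn: "bernoulli_remainder l r n g x = (I + J) / fact n"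
    unfolding bernoulli_remainder_def by (intro integral_unique has_integral_periodic_bernoulli lr x)
  have p1: "((\<lambda>t. ?B (Suc n) (x - t + l) * h t) has_integral
      (?B (Suc n) l * g x - ?B (Suc n) x * g l + real (Suc n) * I)) {l..x}"
    using parts[of l x "x + l"] x unfolding I_def eqs by simp
  have p2: "((\<lambda>t. ?B (Suc n) (x - t + r) * h t) has_integral
      (?B (Suc n) x * g r - ?B (Suc n) r * g x + real (Suc n) * J)) {x..r}"
    using parts[of x r "x + r"] x unfolding J_def eqs by simp
  have "bernoulli_remainder l r (Suc n) h x = (?B (Suc n) l * g x - ?B (Suc n) x * g l + real (Suc n) * I
      + (?B (Suc n) x * g r - ?B (Suc n) r * g x + real (Suc n) * J)) / fact (Suc n)"
    unfolding bernoulli_remainder_def by (intro integral_unique has_integral_periodic_bernoulli lr x p1 p2)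
  also have "\<dots> = (?B (Suc n) x * (g r - g l) - (?B (Suc n) r - ?B (Suc n) l) * g x
      + real (Suc n) * (I + J)) / fact (Suc n)"
    by (simp add: algebra_simps)
  also have "?B (Suc n) r - ?B (Suc n) l = (if n = 0 then 1 else 0)"
    using scaled_bernoulli_endpoints[OF lr, of "Suc n"] by simp
  also have "(?B (Suc n) x * (g r - g l) - (if n = 0 then 1 else 0) * g x
      + real (Suc n) * (I + J)) / fact (Suc n) = ?B (Suc n) x / fact (Suc n) * (g r - g l)
       + (I + J) / fact n - (if n = 0 then g x else 0)"
  proof -
    have f: "(fact (Suc n) :: real) = real (Suc n) * fact n" by simp
    have "real (Suc n) * (I + J) / fact (Suc n) = (I + J) / fact n"
      unfolding f by (simp del: of_nat_Suc)
    moreover have "(if n = 0 then 1 else 0) * g x / fact (Suc n) = (if n = 0 then g x else 0)"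
      by simp
    ultimately show ?thesis by (simp add: add_divide_distrib diff_divide_distrib del: fact_Suc)
  qed
  also have "g r - g l = integral {l..r} h"
    by (rule integral_unique[symmetric], rule abs_cont_fundamental_theorem) (use lr ac der in auto)
  finally show ?thesis unfolding Rn .
qed

theorem bernoulli_expansion:
  assumes lr: "l < r" and x: "x \<in> {l..r}" and n: "1 \<le> n"
    and ac: "\<And>k. k < n \<Longrightarrow> abs_cont_on l r (G k)"
    and der: "\<And>k. k < n \<Longrightarrow>
      AE t in lebesgue. t \<in> {l..r} \<longrightarrow> (G k has_vector_derivative G (Suc k) t) (at t within {l..r})"
  shows "G 0 x = (\<Sum>k\<le>n. scaled_bernoulli l r k x / fact k * integral {l..r} (G k))
     - bernoulli_remainder l r n (G n) x"
proof -
  have "bernoulli_remainder l r 0 (G 0) x = 1 / (r - l) * integral {l..r} (G 0)"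
    by (simp add: bernoulli_remainder_def periodic_bernoulli_def scaled_bernoulli_0 divide_inverse)
  then have base: "bernoulli_remainder l r 0 (G 0) x = scaled_bernoulli l r 0 x / fact 0 * integral {l..r} (G 0)"
    by (simp add: scaled_bernoulli_0)
  have "bernoulli_remainder l r m (G m) x =
     (\<Sum>k\<le>m. scaled_bernoulli l r k x / fact k * integral {l..r} (G k)) - (if m = 0 then 0 else G 0 x)"
    if "m \<le> n" for m
    using that
  proof (induction m)
    case 0
    show ?case using base by simp
  next
    case (Suc m)
    have "bernoulli_remainder l r (Suc m) (G (Suc m)) x =
        scaled_bernoulli l r (Suc m) x / fact (Suc m) * integral {l..r} (G (Suc m))
         + bernoulli_remainder l r m (G m) x - (if m = 0 then G m x else 0)"
      by (rule bernoulli_remainder_step[OF lr x ac der]) (use Suc in auto)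
    then show ?case using Suc by (cases "m = 0") (simp_all del: fact_Suc)
  qed
  from this[of n] n show ?thesis by simp
qed

section \<open>Completed product measures and Fubini's theorem\<close>

interpretation lborel_PiM: product_sigma_finite "\<lambda>_::nat. lborel :: real measure"
  by standard

lemma pair_sigma_finite_PiM_lborel:
  "finite u \<Longrightarrow> pair_sigma_finite (\<Pi>\<^sub>M j\<in>u. lborel :: real measure) (lborel :: real measure)" for u :: "nat set"
  by (intro pair_sigma_finite.intro lborel_PiM.sigma_finite sigma_finite_lborel)

lemma measurable_upd_pair [measurable]:
  "(\<lambda>z. (fst z)(j := snd z)) \<in> (\<Pi>\<^sub>M j\<in>u. lborel) \<Otimes>\<^sub>M lborel \<rightarrow>\<^sub>M (\<Pi>\<^sub>M j\<in>insert j u. lborel :: real measure)"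
  for u :: "nat set"
  using measurable_add_dim[of j u "\<lambda>_. lborel :: real measure"] by (simp add: case_prod_unfold)

text \<open>
  All the Fubini arguments split off one coordinate: the product measure on \<open>insert j u\<close> is the
  image of the product of the measures on \<open>u\<close> and on the line.
\<close>

lemma distr_PiM_insert:
  fixes u :: "nat set"
  assumes "finite u" "j \<notin> u"
  shows "distr ((\<Pi>\<^sub>M j\<in>u. lborel) \<Otimes>\<^sub>M lborel) (\<Pi>\<^sub>M j\<in>insert j u. lborel :: real measure)
     (\<lambda>z. (fst z)(j := snd z)) = (\<Pi>\<^sub>M j\<in>insert j u. lborel)"
proof (rule lborel_PiM.PiM_eqI)
  fix A :: "nat \<Rightarrow> real set" assume A: "\<And>i. i \<in> insert j u \<Longrightarrow> A i \<in> sets lborel"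
  have "(\<lambda>z. (fst z)(j := snd z)) -` Pi\<^sub>E (insert j u) A \<inter> space ((\<Pi>\<^sub>M j\<in>u. lborel) \<Otimes>\<^sub>M lborel)
      = Pi\<^sub>E u A \<times> A j"
  proof (intro set_eqI iffI)
    fix z assume "z \<in> Pi\<^sub>E u A \<times> A j"
    then show "z \<in> (\<lambda>z. (fst z)(j := snd z)) -` Pi\<^sub>E (insert j u) A \<inter> space ((\<Pi>\<^sub>M j\<in>u. lborel) \<Otimes>\<^sub>M lborel)"
      by (auto simp: space_pair_measure space_PiM PiE_iff extensional_def)
  next
    fix z assume z: "z \<in> (\<lambda>z. (fst z)(j := snd z)) -` Pi\<^sub>E (insert j u) A \<inter> space ((\<Pi>\<^sub>M j\<in>u. lborel) \<Otimes>\<^sub>M lborel)"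
    then have "(fst z)(j := snd z) \<in> Pi\<^sub>E (insert j u) A" "fst z \<in> extensional u"
      by (auto simp: space_pair_measure space_PiM PiE_iff)
    then have "snd z \<in> A j" "\<And>i. i \<in> u \<Longrightarrow> fst z i \<in> A i"
      using assms(2) by (auto simp: PiE_iff split: if_splits) 
    with \<open>fst z \<in> extensional u\<close> show "z \<in> Pi\<^sub>E u A \<times> A j"
      by (auto simp: mem_Times_iff PiE_iff)
  qed
  then show "emeasure (distr ((\<Pi>\<^sub>M j\<in>u. lborel) \<Otimes>\<^sub>M lborel) (\<Pi>\<^sub>M j\<in>insert j u. lborel)
     (\<lambda>z. (fst z)(j := snd z))) (Pi\<^sub>E (insert j u) A) = (\<Prod>i\<in>insert j u. emeasure lborel (A i))"
    using A assms
    by (subst emeasure_distr)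
      (auto simp: lborel.emeasure_pair_measure_Times lborel_PiM.emeasure_PiM mult.commute
        intro!: sets_PiM_I_finite)
qed (use assms in auto)

lemma AE_PiM_insertD:
  fixes u :: "nat set"
  assumes u: "finite u" "j \<notin> u"
    and AE: "AE y in (\<Pi>\<^sub>M j\<in>insert j u. lborel :: real measure). Q y"
  shows "AE y in (\<Pi>\<^sub>M j\<in>u. lborel). AE t in lborel. Q (y(j := t))"
proof -
  interpret pair_sigma_finite "\<Pi>\<^sub>M j\<in>u. lborel :: real measure" "lborel :: real measure"
    by (rule pair_sigma_finite_PiM_lborel[OF u(1)])
  have "AE z in (\<Pi>\<^sub>M j\<in>u. lborel) \<Otimes>\<^sub>M lborel. Q ((fst z)(j := snd z))"
    using AE by (intro AE_distrD[OF measurable_upd_pair]) (simp only: distr_PiM_insert[OF u])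
  from AE_pair[OF this] show ?thesis by simp
qed

lemma AE_PiM_pairI:
  fixes u :: "nat set"
  assumes AE: "AE y in (\<Pi>\<^sub>M j\<in>u. lborel :: real measure). Q y"
  shows "AE z in (\<Pi>\<^sub>M j\<in>u. lborel) \<Otimes>\<^sub>M (lborel :: real measure). Q (fst z)"
proof -
  obtain N where N: "N \<in> null_sets (\<Pi>\<^sub>M j\<in>u. lborel :: real measure)"
    and NQ: "\<And>y. y \<in> space (\<Pi>\<^sub>M j\<in>u. lborel :: real measure) \<Longrightarrow> y \<notin> N \<Longrightarrow> Q y"
    using AE by (rule AE_E3) (rule that, auto)
  have "N \<times> UNIV \<in> null_sets ((\<Pi>\<^sub>M j\<in>u. lborel :: real measure) \<Otimes>\<^sub>M (lborel :: real measure))"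
    using N by (auto simp: null_sets_def lborel.emeasure_pair_measure_Times)
  then have "AE z in (\<Pi>\<^sub>M j\<in>u. lborel) \<Otimes>\<^sub>M (lborel :: real measure). z \<notin> N \<times> UNIV" by (rule AE_not_in)
  then show ?thesis using AE_space
    by eventually_elim (auto simp: space_pair_measure mem_Times_iff intro: NQ)
qed

text \<open>
  Restriction to fewer coordinates does not preserve the (infinite) measure, but preimages of null
  sets are null sets.
\<close>

lemma AE_PiM_insertI:
  fixes u :: "nat set"
  assumes u: "finite u" "j \<notin> u"
    and AE: "AE y in (\<Pi>\<^sub>M j\<in>u. lborel :: real measure). Q y"
  shows "AE y in (\<Pi>\<^sub>M j\<in>insert j u. lborel). Q (restrict y u)"
proof -
  interpret pair_sigma_finite "\<Pi>\<^sub>M j\<in>u. lborel :: real measure" "lborel :: real measure"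
    by (rule pair_sigma_finite_PiM_lborel[OF u(1)])
  obtain N where N: "N \<in> null_sets (\<Pi>\<^sub>M j\<in>u. lborel :: real measure)"
    and NQ: "\<And>y. y \<in> space (\<Pi>\<^sub>M j\<in>u. lborel :: real measure) \<Longrightarrow> y \<notin> N \<Longrightarrow> Q y"
    using AE by (rule AE_E3) (rule that, auto)
  have [measurable]: "N \<in> sets (\<Pi>\<^sub>M j\<in>u. lborel :: real measure)" using N by auto
  have res [measurable]: "(\<lambda>y. restrict y u) \<in> (\<Pi>\<^sub>M j\<in>insert j u. lborel :: real measure) \<rightarrow>\<^sub>M (\<Pi>\<^sub>M j\<in>u. lborel)"
    by (rule measurable_restrict_subset) auto
  have "AE z in (\<Pi>\<^sub>M j\<in>u. lborel) \<Otimes>\<^sub>M (lborel :: real measure). fst z \<notin> N"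
    by (rule AE_PiM_pairI[OF AE_not_in[OF N]])
  then have "AE z in (\<Pi>\<^sub>M j\<in>u. lborel) \<Otimes>\<^sub>M lborel. restrict ((fst z)(j := snd z)) u \<notin> N"
    using AE_space
  proof eventually_elim
    case (elim z)
    then have "restrict ((fst z)(j := snd z)) u = fst z"
      using u(2) by (auto simp: space_pair_measure space_PiM fun_eq_iff PiE_iff extensional_def)
    then show ?case using elim(1) by simp
  qed
  then have "AE y in (\<Pi>\<^sub>M j\<in>insert j u. lborel :: real measure). restrict y u \<notin> N"
    by (subst distr_PiM_insert[OF u, symmetric], subst AE_distr_iff) auto
  then show ?thesis using AE_space
  proof eventually_elim
    case (elim y)
    then show ?case using measurable_space[OF res] by (intro NQ) auto
  qed
qed

lemma AE_PiM_superset: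
  fixes u :: "nat set"
  assumes "finite u" "S \<subseteq> u"
    and "AE y in (\<Pi>\<^sub>M j\<in>S. lborel :: real measure). Q y"
  shows "AE y in (\<Pi>\<^sub>M j\<in>u. lborel). Q (restrict y S)"
proof -
  have "AE y in (\<Pi>\<^sub>M j\<in>S \<union> T. lborel). Q (restrict y S)" if "finite T" "S \<inter> T = {}" for T
    using that
  proof (induction T rule: finite_induct)
    case empty
    have "AE y in (\<Pi>\<^sub>M j\<in>S. lborel). Q (restrict y S)" using assms(3) AE_space
    proof eventually_elim
      case (elim y)
      then have "restrict y S = y" by (auto simp: space_PiM PiE_iff extensional_restrict)
      then show ?case using elim(1) by simp
    qed
    then show ?case by (simp only: Un_empty_right)
  next
    case (insert j T)
    have "finite S" using assms by (auto intro: finite_subset)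
    have "AE y in (\<Pi>\<^sub>M j\<in>S \<union> T. lborel). Q (restrict y S)"
      using insert by blast
    from AE_PiM_insertI[OF _ _ this, of j] insert \<open>finite S\<close>
    have "AE y in (\<Pi>\<^sub>M j\<in>insert j (S \<union> T). lborel). Q (restrict (restrict y (S \<union> T)) S)"
      by blast
    moreover have "restrict (restrict y (S \<union> T)) S = restrict y S" for y :: "nat \<Rightarrow> real" by auto
    ultimately show ?case by (simp only: Un_insert_right)
  qed
  note * = this[of "u - S"]
  have "S \<union> (u - S) = u" using assms(2) by auto
  with * assms(1) show ?thesis by (metis Diff_disjoint finite_Diff)
qed

lemma borel_measurable_completion_AE:
  fixes g g' :: "'a \<Rightarrow> real"
  assumes g': "g' \<in> borel_measurable (completion M)" and eq: "AE x in M. g x = g' x"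
  shows "g \<in> borel_measurable (completion M)"
proof (rule measurableI)
  fix A :: "real set" assume A: "A \<in> sets borel"
  show "g -` A \<inter> space (completion M) \<in> sets (completion M)"
  proof (rule completion.in_sets_AE)
    show "g' -` A \<inter> space (completion M) \<in> sets (completion M)"
      using g' A by (rule measurable_sets)
    show "AE x in completion M. x \<in> g' -` A \<inter> space (completion M) \<longleftrightarrow> x \<in> g -` A \<inter> space (completion M)"
      using AE_completion[OF eq] by eventually_elim auto
  qed auto
qed auto

lemma integrable_completion_AE:
  fixes g g' :: "'a \<Rightarrow> real"
  assumes g': "integrable (completion M) g'" and eq: "AE x in M. g x = g' x"
  shows "integrable (completion M) g" "integral\<^sup>L (completion M) g = integral\<^sup>L (completion M) g'"
proof -
  have m: "g \<in> borel_measurable (completion M)"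
    by (rule borel_measurable_completion_AE[OF _ eq]) (use g' in auto)
  have eq': "AE x in completion M. g x = g' x" by (rule AE_completion[OF eq])
  show "integrable (completion M) g"
    using g' m eq' by (subst integrable_cong_AE[where g=g']) auto
  show "integral\<^sup>L (completion M) g = integral\<^sup>L (completion M) g'"
    using g' m eq' by (intro integral_cong_AE) auto
qed

text \<open>
  Integrable functions of a completed measure are handled through integrable representatives for
  the measure itself, to which Fubini's theorem for product measures applies.
\<close>

lemma integrable_completionE:
  fixes g :: "'a \<Rightarrow> real"
  assumes "integrable (completion M) g"
  obtains g' where "integrable M g'" "AE x in M. g x = g' x"
    "integral\<^sup>L (completion M) g = integral\<^sup>L M g'"
proof -
  obtain g' where g': "g' \<in> borel_measurable M" and eq: "AE x in M. g x = g' x"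
    using completion_ex_borel_measurable_real[OF borel_measurable_integrable[OF assms]] by (rule bexE)
  have g'c: "g' \<in> borel_measurable (completion M)" using g' by (rule measurable_completion)
  have eq': "AE x in completion M. g x = g' x" by (rule AE_completion[OF eq])
  have "integrable (completion M) g'"
    by (rule integrable_cong_AE_imp[OF assms g'c eq'])
  moreover have "integral\<^sup>L (completion M) g = integral\<^sup>L (completion M) g'"
    using assms g'c eq' by (intro integral_cong_AE) auto
  ultimately show ?thesis
    using that[of g'] g' eq by (simp add: integrable_completion integral_completion)
qed

lemma integrable_completionI:
  fixes g :: "'a \<Rightarrow> real"
  assumes g': "integrable M g'" and eq: "AE x in M. g x = g' x"
  shows "integrable (completion M) g" "integral\<^sup>L (completion M) g = integral\<^sup>L M g'"
proof -
  have g'c: "integrable (completion M) g'" using g' by (subst integrable_completion) auto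
  show "integrable (completion M) g" by (rule integrable_completion_AE(1)[OF g'c eq])
  show "integral\<^sup>L (completion M) g = integral\<^sup>L M g'"
    using integrable_completion_AE(2)[OF g'c eq] g' by (simp add: integral_completion)
qed

lemma fubini_leb_on:
  fixes G :: "(nat \<Rightarrow> real) \<Rightarrow> real"
  assumes u: "finite u" "j \<notin> u" and G: "integrable (leb_on (insert j u)) G"
  shows "AE y in (\<Pi>\<^sub>M j\<in>u. lborel). integrable lebesgue (\<lambda>t. G (y(j := t)))"
    and "integrable (leb_on u) (\<lambda>y. LINT t|lebesgue. G (y(j := t)))"
    and "(LINT y|leb_on u. LINT t|lebesgue. G (y(j := t))) = integral\<^sup>L (leb_on (insert j u)) G"
proof -
  interpret pair_sigma_finite "\<Pi>\<^sub>M j\<in>u. lborel :: real measure" "lborel :: real measure"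
    by (rule pair_sigma_finite_PiM_lborel[OF u(1)])
  obtain G' where G': "integrable (\<Pi>\<^sub>M j\<in>insert j u. lborel) G'"
    and eq: "AE y in (\<Pi>\<^sub>M j\<in>insert j u. lborel). G y = G' y"
    and int: "integral\<^sup>L (leb_on (insert j u)) G = integral\<^sup>L (\<Pi>\<^sub>M j\<in>insert j u. lborel) G'"
    using G unfolding leb_on_def
    by (rule integrable_completionE) (rule that, assumption, assumption, simp add: leb_on_def)
  have Gm [measurable]: "G' \<in> borel_measurable (\<Pi>\<^sub>M j\<in>insert j u. lborel)" using G' by auto
  have Gp: "integrable ((\<Pi>\<^sub>M j\<in>u. lborel) \<Otimes>\<^sub>M lborel) (\<lambda>z. G' ((fst z)(j := snd z)))"
    using G' by (intro integrable_distr[OF measurable_upd_pair]) (simp add: distr_PiM_insert[OF u])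
  have Gi: "integral\<^sup>L ((\<Pi>\<^sub>M j\<in>u. lborel) \<Otimes>\<^sub>M lborel) (\<lambda>z. G' ((fst z)(j := snd z)))
      = integral\<^sup>L (\<Pi>\<^sub>M j\<in>insert j u. lborel) G'"
    using integral_distr[OF measurable_upd_pair, of G' j u] by (simp add: distr_PiM_insert[OF u])
  have ae: "AE y in (\<Pi>\<^sub>M j\<in>u. lborel). integrable lebesgue (\<lambda>t. G (y(j := t))) \<and>
      (LINT t|lebesgue. G (y(j := t))) = (LINT t|lborel. G' (y(j := t)))"
    using AE_PiM_insertD[OF u eq] AE_integrable_fst'[OF Gp]
  proof eventually_elim
    case (elim y)
    then show ?case
      using integrable_completionI[of lborel "\<lambda>t. G' (y(j := t))" "\<lambda>t. G (y(j := t))"] by simp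
  qed
  show "AE y in (\<Pi>\<^sub>M j\<in>u. lborel). integrable lebesgue (\<lambda>t. G (y(j := t)))"
    using ae by eventually_elim simp
  have ae': "AE y in (\<Pi>\<^sub>M j\<in>u. lborel). (LINT t|lebesgue. G (y(j := t))) = (LINT t|lborel. G' (y(j := t)))"
    using ae by eventually_elim simp
  have "integrable (\<Pi>\<^sub>M j\<in>u. lborel) (\<lambda>y. LINT t|lborel. G' (y(j := t)))"
    using integrable_fst'[OF Gp] by simp
  note I = integrable_completionI[OF this ae']
  show "integrable (leb_on u) (\<lambda>y. LINT t|lebesgue. G (y(j := t)))"
    using I(1) by (simp add: leb_on_def)
  show "(LINT y|leb_on u. LINT t|lebesgue. G (y(j := t))) = integral\<^sup>L (leb_on (insert j u)) G"
    using I(2) integral_fst'[OF Gp] Gi int by (simp add: leb_on_def)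
qed

lemma box_on_measurable [measurable]:
  "finite u \<Longrightarrow> box_on u a b \<in> sets (\<Pi>\<^sub>M j\<in>u. lborel)"
  unfolding box_on_def by (intro sets_PiM_I_finite) auto

lemma box_on_insert_upd:
  assumes "y \<in> extensional u" "j \<notin> u"
  shows "y(j := t) \<in> box_on (insert j u) a b \<longleftrightarrow> y \<in> box_on u a b \<and> t \<in> {a j..b j}"
proof
  assume L: "y(j := t) \<in> box_on (insert j u) a b"
  have "y i \<in> {a i..b i}" if "i \<in> u" for i
  proof -
    have "i \<noteq> j" using that assms(2) by metis
    then show ?thesis using PiE_mem[OF L[unfolded box_on_def], of i] that by simp
  qed
  moreover have "t \<in> {a j..b j}"
    using PiE_mem[OF L[unfolded box_on_def], of j] by auto
  ultimately show "y \<in> box_on u a b \<and> t \<in> {a j..b j}"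
    using assms(1) by (auto simp: box_on_def PiE_iff)
next
  assume "y \<in> box_on u a b \<and> t \<in> {a j..b j}"
  then show "y(j := t) \<in> box_on (insert j u) a b"
    by (auto simp: box_on_def PiE_iff extensional_def)
qed

lemma box_on_indicator_upd:
  assumes "y \<in> extensional u" "j \<notin> u"
  shows "(indicator (box_on (insert j u) a b) (y(j := t)) :: real) =
    indicator (box_on u a b) y * indicator {a j..b j} t"
  using box_on_insert_upd[OF assms, of t a b] by (simp add: indicator_def del: atLeastAtMost_iff)

lemma fubini_box_on:
  fixes G :: "(nat \<Rightarrow> real) \<Rightarrow> real"
  assumes u: "finite u" "j \<notin> u"
    and G: "set_integrable (leb_on (insert j u)) (box_on (insert j u) a b) G"
  shows "AE y in (\<Pi>\<^sub>M j\<in>u. lborel). y \<in> box_on u a b \<longrightarrow> set_integrable lebesgue {a j..b j} (\<lambda>t. G (y(j := t)))"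
    and "set_integrable (leb_on u) (box_on u a b) (\<lambda>y. LINT t:{a j..b j}|lebesgue. G (y(j := t)))"
    and "(LINT y:box_on u a b|leb_on u. LINT t:{a j..b j}|lebesgue. G (y(j := t)))
       = (LINT y:box_on (insert j u) a b|leb_on (insert j u). G y)"
proof -
  let ?G = "\<lambda>y. indicator (box_on (insert j u) a b) y *\<^sub>R G y"
  have G': "integrable (leb_on (insert j u)) ?G"
    using G by (simp add: set_integrable_def)
  note F = fubini_leb_on[OF u G']
  have eq: "?G (y(j := t)) = indicator (box_on u a b) y * (indicator {a j..b j} t *\<^sub>R G (y(j := t)))"
    if "y \<in> space (\<Pi>\<^sub>M j\<in>u. lborel :: real measure)" for y t
  proof -
    have "y \<in> extensional u" using that by (auto simp: space_PiM PiE_iff)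
    then show ?thesis using box_on_indicator_upd[OF _ u(2), of y a b t] by simp
  qed
  have eqi: "(LINT t|lebesgue. ?G (y(j := t))) = indicator (box_on u a b) y *\<^sub>R (LINT t:{a j..b j}|lebesgue. G (y(j := t)))"
    if "y \<in> space (\<Pi>\<^sub>M j\<in>u. lborel :: real measure)" for y
    unfolding eq[OF that] by (simp add: set_lebesgue_integral_def)
  have sp: "space (leb_on u) = space (\<Pi>\<^sub>M j\<in>u. lborel :: real measure)"
    by (simp add: leb_on_def)
  show "AE y in (\<Pi>\<^sub>M j\<in>u. lborel). y \<in> box_on u a b \<longrightarrow> set_integrable lebesgue {a j..b j} (\<lambda>t. G (y(j := t)))"
    using F(1) AE_space
  proof eventually_elim
    case (elim y)
    show ?case
      using elim(1) unfolding eq[OF elim(2)]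
      by (cases "y \<in> box_on u a b") (simp_all add: set_integrable_def)
  qed
  show "set_integrable (leb_on u) (box_on u a b) (\<lambda>y. LINT t:{a j..b j}|lebesgue. G (y(j := t)))"
    using F(2) unfolding set_integrable_def
    by (subst Bochner_Integration.integrable_cong[OF refl eqi[symmetric]]) (auto simp: sp)
  have "(LINT y:box_on u a b|leb_on u. LINT t:{a j..b j}|lebesgue. G (y(j := t)))
       = (LINT y|leb_on u. LINT t|lebesgue. ?G (y(j := t)))"
    unfolding set_lebesgue_integral_def[of "leb_on u"]
    by (intro Bochner_Integration.integral_cong refl eqi[symmetric]) (auto simp: sp)
  with F(3) show "(LINT y:box_on u a b|leb_on u. LINT t:{a j..b j}|lebesgue. G (y(j := t)))
       = (LINT y:box_on (insert j u) a b|leb_on (insert j u). G y)"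
    by (simp add: set_lebesgue_integral_def)
qed

lemma set_integrable_leb_on_AE:
  fixes F G :: "(nat \<Rightarrow> real) \<Rightarrow> real"
  assumes G: "set_integrable (leb_on u) A G"
    and eq: "AE y in (\<Pi>\<^sub>M j\<in>u. lborel). y \<in> A \<longrightarrow> F y = G y"
  shows "set_integrable (leb_on u) A F"
    and "(LINT y:A|leb_on u. F y) = (LINT y:A|leb_on u. G y)"
proof -
  have "AE y in (\<Pi>\<^sub>M j\<in>u. lborel). indicator A y *\<^sub>R F y = indicator A y *\<^sub>R G y"
    using eq by eventually_elim (auto simp: indicator_def)
  from integrable_completion_AE[OF G[unfolded set_integrable_def leb_on_def] this]
  show "set_integrable (leb_on u) A F" "(LINT y:A|leb_on u. F y) = (LINT y:A|leb_on u. G y)"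
    by (simp_all add: set_integrable_def set_lebesgue_integral_def leb_on_def)
qed

lemma set_integrable_leb_on_mult_bounded:
  fixes k G :: "(nat \<Rightarrow> real) \<Rightarrow> real"
  assumes G: "set_integrable (leb_on u) A G"
    and k: "k \<in> borel_measurable (\<Pi>\<^sub>M j\<in>u. lborel)" and B: "\<And>y. \<bar>k y\<bar> \<le> B"
  shows "set_integrable (leb_on u) A (\<lambda>y. k y * G y)"
proof -
  have km [measurable]: "k \<in> borel_measurable (leb_on u)"
    using k unfolding leb_on_def by (rule measurable_completion)
  have G': "integrable (leb_on u) (\<lambda>y. indicator A y *\<^sub>R G y)" using G by (simp add: set_integrable_def)
  have "integrable (leb_on u) (\<lambda>y. k y * (indicator A y *\<^sub>R G y))"
  proof (rule Bochner_Integration.integrable_bound)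
    show "integrable (leb_on u) (\<lambda>y. B * (indicator A y *\<^sub>R G y))" using G' by simp
    show "(\<lambda>y. k y * (indicator A y *\<^sub>R G y)) \<in> borel_measurable (leb_on u)"
      using borel_measurable_integrable[OF G'] by measurable
    show "AE y in leb_on u. norm (k y * (indicator A y *\<^sub>R G y)) \<le> norm (B * (indicator A y *\<^sub>R G y))"
    proof (intro AE_I2)
      fix y
      have "\<bar>k y\<bar> \<le> \<bar>B\<bar>" using B[of y] by linarith
      then show "norm (k y * (indicator A y *\<^sub>R G y)) \<le> norm (B * (indicator A y *\<^sub>R G y))"
        unfolding norm_mult by (intro mult_right_mono) auto
    qed
  qed
  then show ?thesis by (simp add: set_integrable_def mult.left_commute)
qed

text \<open>
  The assumption on \<open>F\<close> holds for almost every \<open>y\<close> and all \<open>t\<close>, so the exceptional set is a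
  cylinder over a null set. Therefore \<open>F\<close> agrees almost everywhere with the jointly measurable
  function \<open>W\<close> in the proof, which is dominated by an integrable function of \<open>y\<close> times the
  indicator function of \<open>[a j, b j]\<close>.
\<close>

lemma set_integrable_leb_on_antiderivative:
  fixes F Q H :: "(nat \<Rightarrow> real) \<Rightarrow> real"
  assumes u: "finite u" "j \<notin> u"
    and Q: "set_integrable (leb_on u) (box_on u a b) Q"
    and H: "set_integrable (leb_on (insert j u)) (box_on (insert j u) a b) H"
    and F: "AE y in (\<Pi>\<^sub>M j\<in>u. lborel). y \<in> box_on u a b \<longrightarrow>
      (\<forall>t\<in>{a j..b j}. F (y(j := t)) = Q y + integral {a j..t} (\<lambda>r. H (y(j := r))))"
  shows "set_integrable (leb_on (insert j u)) (box_on (insert j u) a b) F"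
proof -
  interpret pair_sigma_finite "\<Pi>\<^sub>M j\<in>u. lborel :: real measure" "lborel :: real measure"
    by (rule pair_sigma_finite_PiM_lborel[OF u(1)])
  obtain Q' where Q': "integrable (\<Pi>\<^sub>M j\<in>u. lborel) Q'"
    and Qeq: "AE y in (\<Pi>\<^sub>M j\<in>u. lborel). indicator (box_on u a b) y *\<^sub>R Q y = Q' y"
    using Q unfolding leb_on_def set_integrable_def by (rule integrable_completionE) (rule that)
  obtain H' where H': "integrable (\<Pi>\<^sub>M j\<in>insert j u. lborel) H'"
    and Heq: "AE y in (\<Pi>\<^sub>M j\<in>insert j u. lborel). indicator (box_on (insert j u) a b) y *\<^sub>R H y = H' y"
    using H unfolding leb_on_def set_integrable_def by (rule integrable_completionE) (rule that)
  have [measurable]: "Q' \<in> borel_measurable (\<Pi>\<^sub>M j\<in>u. lborel)"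
    "H' \<in> borel_measurable (\<Pi>\<^sub>M j\<in>insert j u. lborel)" using Q' H' by auto
  have [measurable]: "box_on u a b \<in> sets (\<Pi>\<^sub>M j\<in>u. lborel)" using u by simp
  have Hp: "integrable ((\<Pi>\<^sub>M j\<in>u. lborel) \<Otimes>\<^sub>M lborel) (\<lambda>z. H' ((fst z)(j := snd z)))"
    using H' by (intro integrable_distr[OF measurable_upd_pair]) (simp add: distr_PiM_insert[OF u])
  have Hpm [measurable]: "(\<lambda>z. H' ((fst z)(j := snd z))) \<in> borel_measurable ((\<Pi>\<^sub>M j\<in>u. lborel) \<Otimes>\<^sub>M lborel)"
    using Hp by auto
  define W where "W z = indicator (box_on u a b) (fst z) * (indicator {a j..b j} (snd z) *
      (Q' (fst z) + (LINT r|lborel. indicator {a j..snd z} r * H' ((fst z)(j := r)))))" for z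
  define V where "V y = \<bar>Q' y\<bar> + (LINT r|lborel. \<bar>H' (y(j := r))\<bar>)" for y
  have V: "integrable (\<Pi>\<^sub>M j\<in>u. lborel) V"
    unfolding V_def using integrable_fst'[OF integrable_abs[OF Hp]] Q' by simp
  then have [measurable]: "V \<in> borel_measurable (\<Pi>\<^sub>M j\<in>u. lborel)" by auto
  have Vp: "integrable ((\<Pi>\<^sub>M j\<in>u. lborel) \<Otimes>\<^sub>M lborel) (\<lambda>z. V (fst z) * indicator {a j..b j} (snd z))"
  proof (rule Fubini_integrable)
    have "(\<lambda>y. LINT t|lborel. norm (V (fst (y, t)) * indicator {a j..b j} (snd (y, t))))
        = (\<lambda>y. \<bar>V y\<bar> * (LINT t|lborel. indicator {a j..b j} t))"
      by (simp add: abs_mult)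
    then show "integrable (\<Pi>\<^sub>M j\<in>u. lborel) (\<lambda>y. LINT t|lborel. norm (V (fst (y, t)) * indicator {a j..b j} (snd (y, t))))"
      using V integrable_real_indicator[of "{a j..b j}" lborel] by simp
  qed (auto intro!: integrable_real_indicator simp: emeasure_lborel_Icc_eq)
  have Wm [measurable]: "W \<in> borel_measurable ((\<Pi>\<^sub>M j\<in>u. lborel) \<Otimes>\<^sub>M lborel)"
  proof -
    have [measurable]: "(\<lambda>w. H' ((fst (fst w))(j := snd w))) \<in>
        borel_measurable (((\<Pi>\<^sub>M j\<in>u. lborel) \<Otimes>\<^sub>M lborel) \<Otimes>\<^sub>M lborel)"
    proof -
      have "(\<lambda>w::(((nat \<Rightarrow> real) \<times> real) \<times> real). (fst (fst w), snd w)) \<in>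
         ((\<Pi>\<^sub>M j\<in>u. lborel) \<Otimes>\<^sub>M lborel) \<Otimes>\<^sub>M lborel \<rightarrow>\<^sub>M (\<Pi>\<^sub>M j\<in>u. lborel) \<Otimes>\<^sub>M lborel"
        by measurable
      from measurable_compose[OF this Hpm] show ?thesis by simp
    qed
    have [measurable]: "(\<lambda>w::(((nat \<Rightarrow> real) \<times> real) \<times> real). indicator {a j..snd (fst w)} (snd w) :: real) \<in>
        borel_measurable (((\<Pi>\<^sub>M j\<in>u. lborel) \<Otimes>\<^sub>M lborel) \<Otimes>\<^sub>M lborel)"
      unfolding indicator_def atLeastAtMost_iff by measurable
    show ?thesis unfolding W_def by measurable
  qed
  have Wp: "integrable ((\<Pi>\<^sub>M j\<in>u. lborel) \<Otimes>\<^sub>M lborel) W"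
  proof (rule Bochner_Integration.integrable_bound[OF Vp Wm])
    have "AE y in (\<Pi>\<^sub>M j\<in>u. lborel). integrable lborel (\<lambda>r. H' (y(j := r)))"
      using AE_integrable_fst'[OF Hp] by simp
    from AE_PiM_pairI[OF this]
    show "AE z in (\<Pi>\<^sub>M j\<in>u. lborel) \<Otimes>\<^sub>M lborel. norm (W z) \<le> norm (V (fst z) * indicator {a j..b j} (snd z))"
    proof eventually_elim
      case (elim z)
      have "\<bar>LINT r|lborel. indicator {a j..snd z} r * H' ((fst z)(j := r))\<bar>
          \<le> (LINT r|lborel. \<bar>indicator {a j..snd z} r * H' ((fst z)(j := r))\<bar>)"
        by (rule integral_abs_bound)
      also have "\<dots> \<le> (LINT r|lborel. \<bar>H' ((fst z)(j := r))\<bar>)"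
        using elim integrable_real_mult_indicator[OF _ elim, of "{a j..snd z}"]
        by (intro integral_mono) (auto simp: indicator_def mult.commute)
      finally have "\<bar>Q' (fst z) + (LINT r|lborel. indicator {a j..snd z} r * H' ((fst z)(j := r)))\<bar> \<le> V (fst z)"
        unfolding V_def by linarith
      then show ?case by (auto simp: W_def abs_mult indicator_def)
    qed
  qed
  define R where "R y = (restrict y u, y j)" for y :: "nat \<Rightarrow> real"
  have Rm [measurable]: "R \<in> (\<Pi>\<^sub>M j\<in>insert j u. lborel) \<rightarrow>\<^sub>M (\<Pi>\<^sub>M j\<in>u. lborel) \<Otimes>\<^sub>M lborel"
    unfolding R_def by (intro measurable_Pair measurable_restrict_subset measurable_component_singleton) auto
  have RW: "integrable (\<Pi>\<^sub>M j\<in>insert j u. lborel) (\<lambda>y. W (R y))"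
  proof -
    have "R ((fst z)(j := snd z)) = z" if "z \<in> space ((\<Pi>\<^sub>M j\<in>u. lborel) \<Otimes>\<^sub>M (lborel :: real measure))" for z
      using that u(2) by (auto simp: R_def space_pair_measure space_PiM PiE_iff extensional_def fun_eq_iff prod_eq_iff)
    then have "integrable ((\<Pi>\<^sub>M j\<in>u. lborel) \<Otimes>\<^sub>M lborel) (\<lambda>z. W (R ((fst z)(j := snd z))))"
      using Wp by (subst Bochner_Integration.integrable_cong[OF refl, where g=W]) auto
    then have "integrable (distr ((\<Pi>\<^sub>M j\<in>u. lborel) \<Otimes>\<^sub>M lborel) (\<Pi>\<^sub>M j\<in>insert j u. lborel :: real measure)
         (\<lambda>z. (fst z)(j := snd z))) (\<lambda>y. W (R y))"
      by (subst integrable_distr_eq) auto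
    then show ?thesis by (simp add: distr_PiM_insert[OF u])
  qed
  have ae0: "AE y in (\<Pi>\<^sub>M j\<in>u. lborel). y \<in> box_on u a b \<longrightarrow> (\<forall>t\<in>{a j..b j}. F (y(j := t)) = W (y, t))"
    using AE_PiM_insertD[OF u Heq] AE_integrable_fst'[OF Hp] F Qeq AE_space
  proof eventually_elim
    case (elim y)
    show ?case
    proof (intro impI ballI)
      fix t assume y: "y \<in> box_on u a b" and t: "t \<in> {a j..b j}"
      have ey: "y \<in> extensional u" using elim(5) by (auto simp: space_PiM PiE_iff)
      have int: "integrable lborel (\<lambda>r. H' (y(j := r)))" using elim(2) by simp
      have "set_integrable lborel {a j..t} (\<lambda>r. H' (y(j := r)))"
        using integrable_real_mult_indicator[OF _ int, of "{a j..t}"] by (simp add: set_integrable_def mult.commute)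
      then have L: "(LINT r|lborel. indicator {a j..t} r * H' (y(j := r))) = integral {a j..t} (\<lambda>r. H' (y(j := r)))"
        using set_borel_integral_eq_integral(2) by (fastforce simp: set_lebesgue_integral_def)
      have "AE r in lebesgue. indicator (box_on (insert j u) a b) (y(j := r)) *\<^sub>R H (y(j := r)) = H' (y(j := r))"
        using elim(1) by (rule AE_completion)
      then obtain N where N: "N \<in> null_sets lebesgue"
        and NH: "\<And>r. r \<in> space lebesgue \<Longrightarrow> r \<notin> N \<Longrightarrow> indicator (box_on (insert j u) a b) (y(j := r)) *\<^sub>R H (y(j := r)) = H' (y(j := r))"
        by (rule AE_E3) (rule that, auto)
      have "integral {a j..t} (\<lambda>r. H' (y(j := r))) = integral {a j..t} (\<lambda>r. H (y(j := r)))"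
      proof (rule integral_spike)
        show "negligible N" using N by (simp add: negligible_iff_null_sets)
        fix r assume "r \<in> {a j..t} - N"
        then show "H (y(j := r)) = H' (y(j := r))"
          using NH[of r] y t box_on_indicator_upd[OF ey u(2), of a b r] by auto
      qed
      moreover have "Q y = Q' y" using elim(4) y by simp
      ultimately show "F (y(j := t)) = W (y, t)"
        using elim(3) y t L by (simp add: W_def)
    qed
  qed
  have "AE y in (\<Pi>\<^sub>M j\<in>insert j u. lborel).
      indicator (box_on (insert j u) a b) y *\<^sub>R F y = W (R y)"
    using AE_PiM_insertI[OF u ae0] AE_space
  proof eventually_elim
    case (elim y)
    have e: "restrict y u \<in> extensional u" by simp
    have "(restrict y u)(j := y j) = y"
      using elim(2) u by (auto simp: space_PiM PiE_iff extensional_def fun_eq_iff)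
    then have "indicator (box_on (insert j u) a b) y = indicator (box_on u a b) (restrict y u) * (indicator {a j..b j} (y j) :: real)"
      "F y = F ((restrict y u)(j := y j))"
      using box_on_indicator_upd[OF e u(2), of a b "y j"] by simp_all
    then show ?case using elim(1) by (auto simp: R_def W_def indicator_def)
  qed
  from integrable_completionI(1)[OF RW this] show ?thesis
    by (simp add: set_integrable_def leb_on_def)
qed

section \<open>Sections of mixed derivatives on a box\<close>

text \<open>
  The assumptions on \<open>f\<close>. Below, \<open>F \<tau>\<close> is the mixed derivative of order \<open>\<tau>\<close>, \<open>sec u x y\<close> is the
  point with the coordinates of \<open>y\<close> in \<open>u\<close> and those of \<open>x\<close> elsewhere, and \<open>tops \<tau>\<close> is the
  set of the variables in which \<open>\<tau>\<close> has the highest order \<open>\<alpha>\<close>.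
\<close>

locale mixed_abs_cont_box =
  fixes d \<alpha> :: nat and a b :: "nat \<Rightarrow> real" and f :: "(nat \<Rightarrow> real) \<Rightarrow> real"
  assumes \<alpha>: "1 \<le> \<alpha>"
    and ab: "\<And>j. j \<in> {1..d} \<Longrightarrow> a j < b j"
    and mac: "mixed_abs_cont d \<alpha> a b f"
    and tdi: "top_derivs_integrable d \<alpha> a b f"
begin

abbreviation "D \<equiv> {1..d}"
abbreviation "idx \<equiv> D \<rightarrow>\<^sub>E {0..\<alpha>}"
abbreviation "F \<tau> \<equiv> mixed_deriv d a b \<tau> f"
abbreviation "sec u x y \<equiv> merge (D - u) u (x, y)"
abbreviation "tops \<tau> \<equiv> {k \<in> D. \<tau> k = \<alpha>}"

lemma sec_upd:
  assumes "j \<in> D" "j \<notin> u" "u \<subseteq> D"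
  shows "(sec u x y)(j := t) = sec (insert j u) x (y(j := t))"
  using assms by (auto simp: merge_def fun_eq_iff)

lemma sec_at:
  assumes "j \<in> D" "j \<notin> u" "u \<subseteq> D"
  shows "sec u x y = sec (insert j u) x (y(j := x j))"
  using assms by (auto simp: merge_def fun_eq_iff)

lemma sec_fun_upd:
  assumes "j \<in> D" "j \<notin> u" "u \<subseteq> D"
  shows "sec u (x(j := t)) y = sec (insert j u) x (y(j := t))"
  using assms by (auto simp: merge_def fun_eq_iff)

lemma sec_sec:
  assumes "S \<subseteq> u" "u \<subseteq> D"
  shows "sec S (sec u x y) (restrict y S) = sec u x y"
  using assms by (auto simp: merge_def fun_eq_iff)

lemma sec_in_box:
  assumes "x \<in> box_on D a b" "y \<in> box_on u a b" "u \<subseteq> D"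
  shows "sec u x y \<in> box_on D a b"
  using assms by (auto simp: box_on_def PiE_iff merge_def extensional_def)

lemma sec_D: "y \<in> extensional D \<Longrightarrow> sec D x y = y"
  by (auto simp: merge_def extensional_def fun_eq_iff)

lemma sec_empty: "x \<in> extensional D \<Longrightarrow> sec {} x y = x"
  by (auto simp: merge_def extensional_def fun_eq_iff)

lemma idx_upd: "\<tau> \<in> idx \<Longrightarrow> j \<in> D \<Longrightarrow> k \<le> \<alpha> \<Longrightarrow> \<tau>(j := k) \<in> idx"
  by (auto simp: PiE_iff extensional_def)

lemma idx_less:
  assumes "\<tau> \<in> idx" "j \<in> D" "j \<notin> tops \<tau>"
  shows "\<tau> j < \<alpha>"
  using PiE_mem[OF assms(1,2)] assms(2,3) by auto

text \<open>
  The regularity assumption, transferred from almost every value of the coordinates \<open>tops \<tau>\<close> to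
  almost every value of the coordinates in a larger set \<open>u\<close>.
\<close>

lemma section_deriv:
  assumes \<tau>: "\<tau> \<in> idx" and j: "j \<in> D" "j \<notin> u" and u: "u \<subseteq> D" and lt: "\<tau> j < \<alpha>"
    and S: "tops \<tau> \<subseteq> u" and x: "x \<in> box_on D a b"
  shows "AE y in (\<Pi>\<^sub>M j\<in>u. lborel). y \<in> box_on u a b \<longrightarrow>
     abs_cont_on (a j) (b j) (\<lambda>t. F \<tau> (sec (insert j u) x (y(j := t)))) \<and>
     (AE t in lebesgue. t \<in> {a j..b j} \<longrightarrow>
        ((\<lambda>t. F \<tau> (sec (insert j u) x (y(j := t)))) has_vector_derivative
          F (\<tau>(j := Suc (\<tau> j))) (sec (insert j u) x (y(j := t)))) (at t within {a j..b j}))"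
proof -
  have fin: "finite u" using u finite_subset by blast
  have "AE z in leb_on (tops \<tau>). z \<in> box_on (tops \<tau>) a b \<longrightarrow>
           (\<forall>x\<in>box_on D a b.
              let p = (\<lambda>t. (sec (tops \<tau>) x z)(j := t));
                  g = (\<lambda>t. F \<tau> (p t));
                  h = (\<lambda>t. F (\<tau>(j := Suc (\<tau> j))) (p t))
              in abs_cont_on (a j) (b j) g \<and>
                 (if Suc (\<tau> j) < \<alpha>
                  then \<forall>t\<in>{a j..b j}. (g has_vector_derivative h t) (at t within {a j..b j})
                  else AE t in lebesgue. t \<in> {a j..b j} \<longrightarrow>
                         (g has_vector_derivative h t) (at t within {a j..b j})))"
    using mac[unfolded mixed_abs_cont_def, rule_format, OF \<tau> j(1) lt] unfolding Let_def .
  from AE_PiM_superset[OF fin S this[unfolded leb_on_def, THEN AE_completion_iff[THEN iffD1]]]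
  show ?thesis
  proof eventually_elim
    case (elim y)
    show ?case
    proof
      assume y: "y \<in> box_on u a b"
      then have z: "restrict y (tops \<tau>) \<in> box_on (tops \<tau>) a b"
        using S unfolding box_on_def PiE_iff by auto
      have p: "(sec (tops \<tau>) (sec u x y) (restrict y (tops \<tau>)))(j := t) = sec (insert j u) x (y(j := t))" for t
        unfolding sec_sec[OF S u] by (rule sec_upd[OF j u])
      show "abs_cont_on (a j) (b j) (\<lambda>t. F \<tau> (sec (insert j u) x (y(j := t)))) \<and>
        (AE t in lebesgue. t \<in> {a j..b j} \<longrightarrow>
        ((\<lambda>t. F \<tau> (sec (insert j u) x (y(j := t)))) has_vector_derivative
          F (\<tau>(j := Suc (\<tau> j))) (sec (insert j u) x (y(j := t)))) (at t within {a j..b j}))"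
        using elim[rule_format, OF z sec_in_box[OF x y u], unfolded Let_def p]
        by (simp only: split: if_splits) blast+
    qed
  qed
qed

text \<open>
  Integrability of \<open>F \<tau>\<close> in the variables \<open>u\<close>, with the other variables fixed at those of \<open>x\<close>.
\<close>

definition "section_integrable \<tau> u x \<longleftrightarrow>
  set_integrable (leb_on u) (box_on u a b) (\<lambda>y. F \<tau> (sec u x y))"

text \<open>
  The expansion in the variable \<open>j\<close> for the derivatives \<open>F (\<tau>(j := \<tau> j + k))\<close> with \<open>k \<le> n\<close>, with
  Lebesgue integrals.
\<close>

lemma section_expansion:
  assumes \<tau>: "\<tau> \<in> idx" and j: "j \<in> D" "j \<notin> u" and u: "u \<subseteq> D"
    and S: "tops \<tau> \<subseteq> u" and x: "x \<in> box_on D a b"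
    and n: "1 \<le> n" "\<tau> j + n \<le> \<alpha>"
    and int: "\<forall>k\<le>n. section_integrable (\<tau>(j := \<tau> j + k)) (insert j u) x"
  shows "AE y in (\<Pi>\<^sub>M j\<in>u. lborel). y \<in> box_on u a b \<longrightarrow>
     F \<tau> (sec u x y) =
       (\<Sum>k\<le>n. scaled_bernoulli (a j) (b j) k (x j) / fact k *
          (LINT t:{a j..b j}|lebesgue. F (\<tau>(j := \<tau> j + k)) (sec (insert j u) x (y(j := t)))))
       - (LINT t:{a j..b j}|lebesgue. periodic_bernoulli (a j) (b j) n (x j - t + a j) / fact n
            * F (\<tau>(j := \<tau> j + n)) (sec (insert j u) x (y(j := t))))"
proof -
  have fin: "finite u" using u finite_subset by blast
  define G where "G y k t = F (\<tau>(j := \<tau> j + k)) (sec (insert j u) x (y(j := t)))" for y k t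
  have "AE y in (\<Pi>\<^sub>M j\<in>u. lborel). \<forall>k\<in>{..<n}. y \<in> box_on u a b \<longrightarrow> abs_cont_on (a j) (b j) (G y k) \<and>
     (AE t in lebesgue. t \<in> {a j..b j} \<longrightarrow>
        (G y k has_vector_derivative G y (Suc k) t) (at t within {a j..b j}))"
  proof (rule eventually_ball_finite, simp, rule ballI)
    fix k assume k: "k \<in> {..<n}"
    have "\<tau>(j := \<tau> j + k) \<in> idx" using \<tau> j n k by (intro idx_upd) auto
    moreover have "tops (\<tau>(j := \<tau> j + k)) \<subseteq> u" using S n k by auto
    ultimately show "AE y in (\<Pi>\<^sub>M j\<in>u. lborel). y \<in> box_on u a b \<longrightarrow> abs_cont_on (a j) (b j) (G y k) \<and>
     (AE t in lebesgue. t \<in> {a j..b j} \<longrightarrow>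
        (G y k has_vector_derivative G y (Suc k) t) (at t within {a j..b j}))"
      using section_deriv[of "\<tau>(j := \<tau> j + k)" j u x] j u x n k by (simp add: G_def[abs_def])
  qed
  moreover have "AE y in (\<Pi>\<^sub>M j\<in>u. lborel). \<forall>k\<in>{..n}. y \<in> box_on u a b \<longrightarrow>
      set_integrable lebesgue {a j..b j} (G y k)"
  proof (rule eventually_ball_finite, simp, rule ballI)
    fix k assume k: "k \<in> {..n}"
    show "AE y in (\<Pi>\<^sub>M j\<in>u. lborel). y \<in> box_on u a b \<longrightarrow> set_integrable lebesgue {a j..b j} (G y k)"
      using fubini_box_on(1)[OF fin j(2) int[rule_format, unfolded section_integrable_def, of k]] k
      by (simp add: G_def[abs_def])
  qed
  ultimately show ?thesis
  proof eventually_elim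
    case (elim y)
    show ?case
    proof
      assume y: "y \<in> box_on u a b"
      have xj: "x j \<in> {a j..b j}" using x j(1) unfolding box_on_def by (rule PiE_mem)
      have ex: "G y 0 (x j) = (\<Sum>k\<le>n. scaled_bernoulli (a j) (b j) k (x j) / fact k * integral {a j..b j} (G y k))
         - bernoulli_remainder (a j) (b j) n (G y n) (x j)"
        using elim(1) y by (intro bernoulli_expansion ab j xj n) auto
      have i: "set_integrable lebesgue {a j..b j} (G y k)" if "k \<le> n" for k
        using elim(2) y that by auto
      obtain B where B: "\<And>t. \<bar>periodic_bernoulli (a j) (b j) n t\<bar> \<le> B"
        using periodic_bernoulli_bounded[OF ab[OF j(1)]] by blast
      have "set_integrable lebesgue {a j..b j} (\<lambda>t. periodic_bernoulli (a j) (b j) n (x j - t + a j) / fact n * G y n t)"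
      proof -
        have m: "(\<lambda>t. periodic_bernoulli (a j) (b j) n (x j - t + a j) / fact n) \<in> borel_measurable lebesgue"
          by (rule measurable_completion) measurable
        have I: "integrable lebesgue (\<lambda>t. indicator {a j..b j} t *\<^sub>R G y n t)"
          using i[of n] by (simp add: set_integrable_def)
        have "integrable lebesgue (\<lambda>t. periodic_bernoulli (a j) (b j) n (x j - t + a j) / fact n
            * (indicator {a j..b j} t *\<^sub>R G y n t))"
        proof (rule Bochner_Integration.integrable_bound[OF integrable_mult_right[OF I, of "B / fact n"]])
          show "(\<lambda>t. periodic_bernoulli (a j) (b j) n (x j - t + a j) / fact n
            * (indicator {a j..b j} t *\<^sub>R G y n t)) \<in> borel_measurable lebesgue"
            using m borel_measurable_integrable[OF I] by (rule borel_measurable_times)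
          have "\<bar>periodic_bernoulli (a j) (b j) n s\<bar> \<le> \<bar>B\<bar>" for s using B[of s] by linarith
          then show "AE t in lebesgue. norm (periodic_bernoulli (a j) (b j) n (x j - t + a j) / fact n
            * (indicator {a j..b j} t *\<^sub>R G y n t)) \<le> norm (B / fact n * (indicator {a j..b j} t *\<^sub>R G y n t))"
            by (intro AE_I2) (auto simp: abs_mult intro!: mult_right_mono divide_right_mono)
        qed
        then show ?thesis by (simp add: set_integrable_def mult.left_commute)
      qed
      from set_lebesgue_integral_eq_integral(2)[OF this]
      have "bernoulli_remainder (a j) (b j) n (G y n) (x j) =
         (LINT t:{a j..b j}|lebesgue. periodic_bernoulli (a j) (b j) n (x j - t + a j) / fact n * G y n t)"
        by (simp add: bernoulli_remainder_def)
      moreover have "integral {a j..b j} (G y k) = (LINT t:{a j..b j}|lebesgue. G y k t)" if "k \<le> n" for k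
        using set_lebesgue_integral_eq_integral(2)[OF i[OF that]] by simp
      moreover have "G y 0 (x j) = F \<tau> (sec u x y)"
        using sec_at[OF j u, of x y] by (simp add: G_def)
      ultimately show "F \<tau> (sec u x y) =
       (\<Sum>k\<le>n. scaled_bernoulli (a j) (b j) k (x j) / fact k *
          (LINT t:{a j..b j}|lebesgue. F (\<tau>(j := \<tau> j + k)) (sec (insert j u) x (y(j := t)))))
       - (LINT t:{a j..b j}|lebesgue. periodic_bernoulli (a j) (b j) n (x j - t + a j) / fact n
            * F (\<tau>(j := \<tau> j + n)) (sec (insert j u) x (y(j := t))))"
        using ex by (simp add: G_def)
    qed
  qed
qed

lemma kernel_bounded:
  assumes "v \<subseteq> D"
  obtains B where "\<And>y. \<bar>\<Prod>j\<in>v. periodic_bernoulli (a j) (b j) n (x j - y j + a j) / fact n\<bar> \<le> B"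
proof -
  have "\<forall>j. \<exists>B. j \<in> D \<longrightarrow> (\<forall>t. \<bar>periodic_bernoulli (a j) (b j) n t\<bar> \<le> B)"
    using periodic_bernoulli_bounded[OF ab] by metis
  then obtain B where B: "\<And>j t. j \<in> D \<Longrightarrow> \<bar>periodic_bernoulli (a j) (b j) n t\<bar> \<le> B j" by metis
  show ?thesis
  proof (rule that[of "\<Prod>j\<in>v. B j / fact n"])
    fix y :: "nat \<Rightarrow> real"
    show "\<bar>\<Prod>j\<in>v. periodic_bernoulli (a j) (b j) n (x j - y j + a j) / fact n\<bar> \<le> (\<Prod>j\<in>v. B j / fact n)"
      unfolding abs_prod using assms B by (intro prod_mono) (auto intro!: divide_right_mono)
  qed
qed

lemma kernel_measurable:
  assumes "v \<subseteq> u"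
  shows "(\<lambda>y. \<Prod>j\<in>v. periodic_bernoulli (a j) (b j) n (x j - y j + a j) / fact n)
     \<in> borel_measurable (\<Pi>\<^sub>M j\<in>u. lborel)"
proof (rule borel_measurable_prod)
  fix j assume "j \<in> v"
  then have "j \<in> u" using assms by auto
  then have [measurable]: "(\<lambda>y. y j) \<in> (\<Pi>\<^sub>M j\<in>u. lborel :: real measure) \<rightarrow>\<^sub>M borel"
    using measurable_component_singleton[of j u "\<lambda>_. lborel :: real measure"] by simp
  show "(\<lambda>y. periodic_bernoulli (a j) (b j) n (x j - y j + a j) / fact n) \<in> borel_measurable (\<Pi>\<^sub>M j\<in>u. lborel)"
    by measurable
qed

text \<open>
  The expansion, multiplied by a weight \<open>K\<close> which does not depend on the variable \<open>j\<close> and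
  integrated over the variables \<open>u\<close>. It is used with the product of remainder kernels as \<open>K\<close> and
  \<open>n = \<alpha>\<close> for the recurrence, and with \<open>K = 1\<close> and \<open>n = 1\<close> to get the integrability of sections.
\<close>

lemma section_step:
  assumes \<tau>: "\<tau> \<in> idx" and j: "j \<in> D" "j \<notin> u" and u: "u \<subseteq> D"
    and S: "tops \<tau> \<subseteq> u" and x: "x \<in> box_on D a b"
    and n: "1 \<le> n" "\<tau> j + n \<le> \<alpha>"
    and int: "\<forall>k\<le>n. section_integrable (\<tau>(j := \<tau> j + k)) (insert j u) x"
    and K: "K \<in> borel_measurable (\<Pi>\<^sub>M j\<in>insert j u. lborel)" "\<And>y. \<bar>K y\<bar> \<le> B"
      "\<And>y t. K (y(j := t)) = K y"
  shows "set_integrable (leb_on u) (box_on u a b) (\<lambda>y. K y * F \<tau> (sec u x y))"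
    and "(LINT y:box_on u a b|leb_on u. K y * F \<tau> (sec u x y)) =
      (\<Sum>k\<le>n. scaled_bernoulli (a j) (b j) k (x j) / fact k *
          (LINT y:box_on (insert j u) a b|leb_on (insert j u).
             K y * F (\<tau>(j := \<tau> j + k)) (sec (insert j u) x y)))
       - (LINT y:box_on (insert j u) a b|leb_on (insert j u).
            (periodic_bernoulli (a j) (b j) n (x j - y j + a j) / fact n * K y)
            * F (\<tau>(j := \<tau> j + n)) (sec (insert j u) x y))"
proof -
  have fin: "finite u" using u finite_subset by blast
  define B' where "B' k = scaled_bernoulli (a j) (b j) k (x j) / fact k" for k
  define G where "G k y = K y * F (\<tau>(j := \<tau> j + k)) (sec (insert j u) x y)" for k y
  define P where "P t = periodic_bernoulli (a j) (b j) n (x j - t + a j) / fact n" for t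
  define R where "R y = (P (y j) * K y) * F (\<tau>(j := \<tau> j + n)) (sec (insert j u) x y)" for y
  have Gi: "set_integrable (leb_on (insert j u)) (box_on (insert j u) a b) (G k)" if "k \<le> n" for k
    unfolding G_def by (rule set_integrable_leb_on_mult_bounded[OF int[rule_format, OF that, unfolded section_integrable_def] K(1,2)])
  obtain C where C: "\<And>y. \<bar>\<Prod>j\<in>{j}. periodic_bernoulli (a j) (b j) n (x j - y j + a j) / fact n\<bar> \<le> C"
    using kernel_bounded[of "{j}" n x] j by blast
  have Pm: "(\<lambda>y. P (y j)) \<in> borel_measurable (\<Pi>\<^sub>M j\<in>insert j u. lborel)"
    using kernel_measurable[of "{j}" "insert j u" n x] by (simp add: P_def)
  have Ri: "set_integrable (leb_on (insert j u)) (box_on (insert j u) a b) R"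
    unfolding R_def
  proof (rule set_integrable_leb_on_mult_bounded[OF int[rule_format, OF order.refl, unfolded section_integrable_def]])
    show "(\<lambda>y. P (y j) * K y) \<in> borel_measurable (\<Pi>\<^sub>M j\<in>insert j u. lborel)"
      using Pm K(1) by (rule borel_measurable_times)
    show "\<bar>P (y j) * K y\<bar> \<le> C * B" for y
    proof -
      have "\<bar>P (y j)\<bar> \<le> C" using C[of y] by (simp add: P_def)
      moreover have "0 \<le> C" using calculation by linarith
      ultimately show ?thesis unfolding abs_mult using K(2)[of y] by (intro mult_mono) auto
    qed
  qed
  have up: "(y(j := t)) j = t" for y :: "nat \<Rightarrow> real" and t by simp
  have eq: "AE y in (\<Pi>\<^sub>M j\<in>u. lborel). y \<in> box_on u a b \<longrightarrow> K y * F \<tau> (sec u x y) =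
     (\<Sum>k\<le>n. B' k * (LINT t:{a j..b j}|lebesgue. G k (y(j := t))))
     - (LINT t:{a j..b j}|lebesgue. R (y(j := t)))"
    using section_expansion[OF \<tau> j u S x n int]
  proof eventually_elim
    case (elim y)
    have 1: "(LINT t:{a j..b j}|lebesgue. G k (y(j := t))) =
       K y * (LINT t:{a j..b j}|lebesgue. F (\<tau>(j := \<tau> j + k)) (sec (insert j u) x (y(j := t))))" for k
      unfolding G_def K(3) by simp
    have 2: "(LINT t:{a j..b j}|lebesgue. R (y(j := t))) =
       K y * (LINT t:{a j..b j}|lebesgue. P t * F (\<tau>(j := \<tau> j + n)) (sec (insert j u) x (y(j := t))))"
    proof -
      have "R (y(j := t)) = K y * (P t * F (\<tau>(j := \<tau> j + n)) (sec (insert j u) x (y(j := t))))" for t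
        unfolding R_def K(3) up by simp
      then show ?thesis by simp
    qed
    show ?case
    proof
      assume "y \<in> box_on u a b"
      from elim[rule_format, OF this]
      have "K y * F \<tau> (sec u x y) = K y * ((\<Sum>k\<le>n. B' k *
          (LINT t:{a j..b j}|lebesgue. F (\<tau>(j := \<tau> j + k)) (sec (insert j u) x (y(j := t)))))
       - (LINT t:{a j..b j}|lebesgue. P t * F (\<tau>(j := \<tau> j + n)) (sec (insert j u) x (y(j := t)))))"
        unfolding B'_def P_def by (rule arg_cong)
      also have "\<dots> = (\<Sum>k\<le>n. B' k * (LINT t:{a j..b j}|lebesgue. G k (y(j := t))))
         - (LINT t:{a j..b j}|lebesgue. R (y(j := t)))"
        unfolding 1 2 by (simp add: right_diff_distrib sum_distrib_left mult.left_commute)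
      finally show "K y * F \<tau> (sec u x y) = (\<Sum>k\<le>n. B' k * (LINT t:{a j..b j}|lebesgue. G k (y(j := t))))
         - (LINT t:{a j..b j}|lebesgue. R (y(j := t)))" .
    qed
  qed
  have I1: "set_integrable (leb_on u) (box_on u a b) (\<lambda>y. B' k * (LINT t:{a j..b j}|lebesgue. G k (y(j := t))))"
    if "k \<le> n" for k
    using fubini_box_on(2)[OF fin j(2) Gi[OF that]] by (intro set_integrable_mult_right) auto
  have I2: "set_integrable (leb_on u) (box_on u a b) (\<lambda>y. LINT t:{a j..b j}|lebesgue. R (y(j := t)))"
    by (rule fubini_box_on(2)[OF fin j(2) Ri])
  have I1s: "set_integrable (leb_on u) (box_on u a b)
      (\<lambda>y. \<Sum>k\<le>n. B' k * (LINT t:{a j..b j}|lebesgue. G k (y(j := t))))"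
    using I1 unfolding set_integrable_def scaleR_sum_right by (intro Bochner_Integration.integrable_sum) auto
  note I = set_integrable_leb_on_AE[OF set_integral_diff(1)[OF I1s I2] eq]
  show "set_integrable (leb_on u) (box_on u a b) (\<lambda>y. K y * F \<tau> (sec u x y))" by (rule I(1))
  have "(LINT y:box_on u a b|leb_on u. \<Sum>k\<le>n. B' k * (LINT t:{a j..b j}|lebesgue. G k (y(j := t))))
     = (\<Sum>k\<le>n. LINT y:box_on u a b|leb_on u. B' k * (LINT t:{a j..b j}|lebesgue. G k (y(j := t))))"
    using I1 unfolding set_integrable_def set_lebesgue_integral_def scaleR_sum_right
    by (intro Bochner_Integration.integral_sum) auto
  also have "\<dots> = (\<Sum>k\<le>n. B' k * (LINT y:box_on (insert j u) a b|leb_on (insert j u). G k y))"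
    by (intro sum.cong refl) (simp add: fubini_box_on(3)[OF fin j(2) Gi])
  finally have "(LINT y:box_on u a b|leb_on u. K y * F \<tau> (sec u x y)) =
     (\<Sum>k\<le>n. B' k * (LINT y:box_on (insert j u) a b|leb_on (insert j u). G k y))
     - (LINT y:box_on (insert j u) a b|leb_on (insert j u). R y)"
    unfolding I(2) set_integral_diff(2)[OF I1s I2] fubini_box_on(3)[OF fin j(2) Ri] by simp
  then show "(LINT y:box_on u a b|leb_on u. K y * F \<tau> (sec u x y)) =
      (\<Sum>k\<le>n. scaled_bernoulli (a j) (b j) k (x j) / fact k *
          (LINT y:box_on (insert j u) a b|leb_on (insert j u).
             K y * F (\<tau>(j := \<tau> j + k)) (sec (insert j u) x y)))
       - (LINT y:box_on (insert j u) a b|leb_on (insert j u).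
            (periodic_bernoulli (a j) (b j) n (x j - y j + a j) / fact n * K y)
            * F (\<tau>(j := \<tau> j + n)) (sec (insert j u) x y))"
    by (simp add: B'_def G_def R_def P_def)
qed

text \<open>
  Downward induction over \<open>u\<close> from the whole box, where integrability is assumed. When the variable
  \<open>j\<close> is fixed, both derivatives in the expansion with \<open>n = 1\<close> still have an order equal to \<open>\<alpha>\<close>.
\<close>

lemma section_integrable_top:
  assumes "\<tau> \<in> idx" "tops \<tau> \<noteq> {}" "tops \<tau> \<subseteq> u" "u \<subseteq> D" "x \<in> box_on D a b"
  shows "section_integrable \<tau> u x"
  using assms
proof (induction "card (D - u)" arbitrary: u \<tau>)
  case 0
  then have u: "u = D" by auto
  have "set_integrable (leb_on D) (box_on D a b) (F \<tau>)"
    using tdi 0 unfolding top_derivs_integrable_def by blast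
  moreover have "(\<lambda>y. indicator (box_on D a b) y *\<^sub>R F \<tau> (sec D x y)) = (\<lambda>y. indicator (box_on D a b) y *\<^sub>R F \<tau> y)"
  proof
    fix y
    show "indicator (box_on D a b) y *\<^sub>R F \<tau> (sec D x y) = indicator (box_on D a b) y *\<^sub>R F \<tau> y"
    proof (cases "y \<in> box_on D a b")
      case True
      then have "y \<in> extensional D" by (auto simp: box_on_def PiE_iff)
      then show ?thesis by (simp only: sec_D)
    qed simp
  qed
  ultimately show ?case unfolding u section_integrable_def set_integrable_def by simp
next
  case (Suc m)
  then obtain j where j: "j \<in> D" "j \<notin> u" by (metis card.empty Diff_eq_empty_iff nat.distinct(1) subsetI)
  have lt: "\<tau> j < \<alpha>" by (rule idx_less[OF Suc.prems(1) j(1)]) (use j Suc.prems(3) in auto)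
  have "m = card (D - insert j u)"
    using Suc.hyps(2) j by (simp add: card_Diff_insert)
  then have IH: "section_integrable \<tau>' (insert j u) x"
    if "\<tau>' \<in> idx" "tops \<tau>' \<noteq> {}" "tops \<tau>' \<subseteq> insert j u" for \<tau>'
    using Suc.hyps(1)[of "insert j u" \<tau>'] that j Suc.prems by auto
  have "set_integrable (leb_on u) (box_on u a b) (\<lambda>y. 1 * F \<tau> (sec u x y))"
  proof (rule section_step(1)[OF Suc.prems(1) j Suc.prems(4,3,5), where n=1 and B=1])
    show "\<forall>k\<le>1. section_integrable (\<tau>(j := \<tau> j + k)) (insert j u) x"
    proof (intro allI impI IH)
      fix k :: nat assume "k \<le> 1"
      show "\<tau>(j := \<tau> j + k) \<in> idx" using Suc.prems j lt \<open>k \<le> 1\<close> by (intro idx_upd) auto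
      show "tops (\<tau>(j := \<tau> j + k)) \<noteq> {}" using Suc.prems j by auto
      show "tops (\<tau>(j := \<tau> j + k)) \<subseteq> insert j u" using Suc.prems by auto
    qed
  qed (use lt in auto)
  then show ?case by (simp add: section_integrable_def)
qed

lemma section_integrable_empty: "section_integrable \<tau> {} x"
  unfolding section_integrable_def set_integrable_def leb_on_def
  by (rule integrable_completionI(1)[OF _ AE_I2[OF refl]]) (simp add: PiM_empty integrable_count_space)

text \<open>
  Induction over the orders still missing to \<open>\<alpha>\<close>, and for each \<open>\<tau>\<close> upward induction over \<open>u\<close> by
  \<open>F \<tau> (t) = F \<tau> (a j) + \<integral> F (\<tau>(j := Suc (\<tau> j)))\<close> in the variable \<open>j\<close>. The integrand
  either has no order \<open>\<alpha>\<close> and fewer missing orders, or has order \<open>\<alpha>\<close> in \<open>j\<close>.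
\<close>

lemma section_integrable_low:
  assumes "\<tau> \<in> idx" "tops \<tau> = {}" "u \<subseteq> D" "x \<in> box_on D a b"
  shows "section_integrable \<tau> u x"
  using assms
proof (induction "\<Sum>j\<in>D. \<alpha> - \<tau> j" arbitrary: \<tau> u x rule: less_induct)
  case (less \<tau>)
  have "finite u" using less.prems finite_subset by blast
  then show ?case using less.prems(3,4)
  proof (induction u arbitrary: x rule: finite_induct)
    case empty
    show ?case by (rule section_integrable_empty)
  next
    case (insert j u)
    have j: "j \<in> D" "j \<notin> u" and u: "u \<subseteq> D" using insert by auto
    have x: "x \<in> box_on D a b" by fact
    have lt: "\<tau> j < \<alpha>" by (rule idx_less[OF less.prems(1) j(1)]) (use less.prems(2) in auto)
    let ?\<tau> = "\<tau>(j := Suc (\<tau> j))"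
    have \<tau>': "?\<tau> \<in> idx" using less.prems j lt by (intro idx_upd) auto
    have H: "section_integrable ?\<tau> (insert j u) x"
    proof (cases "Suc (\<tau> j) < \<alpha>")
      case True
      then have "tops ?\<tau> = {}" using less.prems by auto
      moreover have "(\<Sum>i\<in>D. \<alpha> - ?\<tau> i) < (\<Sum>i\<in>D. \<alpha> - \<tau> i)"
        using j lt by (intro sum_strict_mono_ex1) auto
      ultimately show ?thesis using less.hyps[of ?\<tau>] \<tau>' j u x by auto
    next
      case False
      then have "tops ?\<tau> = {j}" using less.prems lt j by auto
      then show ?thesis using \<tau>' j u x by (intro section_integrable_top) auto
    qed
    have "x(j := a j) \<in> box_on D a b"
      using x j ab[OF j(1)] by (auto simp: box_on_def PiE_iff extensional_def)
    then have Q: "section_integrable \<tau> u (x(j := a j))" using insert by auto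
    show ?case unfolding section_integrable_def
    proof (rule set_integrable_leb_on_antiderivative[OF \<open>finite u\<close> j(2)
        Q[unfolded section_integrable_def] H[unfolded section_integrable_def]])
      have S: "tops \<tau> \<subseteq> u" by (simp only: less.prems(2) empty_subsetI)
      show "AE y in (\<Pi>\<^sub>M j\<in>u. lborel). y \<in> box_on u a b \<longrightarrow>
        (\<forall>t\<in>{a j..b j}. F \<tau> (sec (insert j u) x (y(j := t))) =
          F \<tau> (sec u (x(j := a j)) y) + integral {a j..t} (\<lambda>r. F ?\<tau> (sec (insert j u) x (y(j := r)))))"
        using section_deriv[OF less.prems(1) j u lt S x]
      proof eventually_elim
        case (elim y)
        show ?case
        proof (intro impI ballI)
          fix t assume y: "y \<in> box_on u a b" and t: "t \<in> {a j..b j}"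
          note e = elim[rule_format, OF y]
          let ?g = "\<lambda>t. F \<tau> (sec (insert j u) x (y(j := t)))"
          have "((\<lambda>r. F ?\<tau> (sec (insert j u) x (y(j := r)))) has_integral (?g t - ?g (a j))) {a j..t}"
          proof (rule abs_cont_fundamental_theorem)
            show "abs_cont_on (a j) t ?g"
              by (rule abs_cont_on_subinterval[OF conjunct1[OF e]]) (use t in auto)
            show "AE s in lebesgue. s \<in> {a j..t} \<longrightarrow>
              (?g has_vector_derivative F ?\<tau> (sec (insert j u) x (y(j := s)))) (at s within {a j..t})"
              using conjunct2[OF e]
            proof eventually_elim
              case (elim s)
              then show ?case using t by (auto intro: has_vector_derivative_within_subset)
            qed
          qed (use t in auto)
          then show "?g t = F \<tau> (sec u (x(j := a j)) y)
              + integral {a j..t} (\<lambda>r. F ?\<tau> (sec (insert j u) x (y(j := r))))"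
            using sec_fun_upd[OF j u, of x "a j" y] by (simp add: integral_unique)
        qed
      qed
    qed
  qed
qed

lemma section_integrable_all:
  assumes "\<tau> \<in> idx" "tops \<tau> \<subseteq> u" "u \<subseteq> D" "x \<in> box_on D a b"
  shows "section_integrable \<tau> u x"
proof (cases "tops \<tau> = {}")
  case True
  then show ?thesis by (rule section_integrable_low[OF assms(1) _ assms(3,4)])
next
  case False
  then show ?thesis by (rule section_integrable_top[OF assms(1) _ assms(2-4)])
qed

end

section \<open>Recurrences over pairs of disjoint sets\<close>

lemma sum_Pow_insert:
  fixes g :: "'b set \<Rightarrow> real"
  assumes "finite v" "j \<notin> v"
  shows "(\<Sum>u\<in>Pow (insert j v). g u) = (\<Sum>u\<in>Pow v. g u) + (\<Sum>u\<in>Pow v. g (insert j u))"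
proof -
  have "inj_on (insert j) (Pow v)"
    using assms(2) by (intro inj_onI) (metis Diff_insert_absorb PowD subsetD)
  then show ?thesis
    using assms unfolding Pow_insert
    by (subst sum.union_disjoint) (auto simp: sum.reindex)
qed

text \<open>
  If \<open>T w v\<close> is a product of \<open>P\<^sub>j\<close> over \<open>w\<close> and \<open>R\<^sub>j\<close> over \<open>v\<close> with \<open>P\<^sub>j + R\<^sub>j = 1\<close>, then the
  following lemmas expand the products of \<open>R\<^sub>j = 1 - P\<^sub>j\<close> and of \<open>1 = P\<^sub>j + R\<^sub>j\<close>. Only the resulting
  recurrence is used.
\<close>

lemma two_set_recurrence_inclusion_exclusion:
  fixes T :: "'b set \<Rightarrow> 'b set \<Rightarrow> real"
  assumes rec: "\<And>w v j. w \<subseteq> D \<Longrightarrow> v \<subseteq> D \<Longrightarrow> w \<inter> v = {} \<Longrightarrow> j \<in> D - (w \<union> v) \<Longrightarrow>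
      T w v = T (insert j w) v + T w (insert j v)"
    and "finite v" "v \<subseteq> D" "w \<subseteq> D" "w \<inter> v = {}"
  shows "T w v = (\<Sum>u\<in>Pow v. (-1) ^ card u * T (w \<union> u) {})"
  using assms(2-)
proof (induction v arbitrary: w rule: finite_induct)
  case (insert j v)
  have "T w (insert j v) = T w v - T (insert j w) v"
    using rec[of w v j] insert by auto
  also have "T w v = (\<Sum>u\<in>Pow v. (-1) ^ card u * T (w \<union> u) {})"
    using insert by auto
  also have "T (insert j w) v = (\<Sum>u\<in>Pow v. (-1) ^ card u * T (insert j w \<union> u) {})"
    by (rule insert.IH) (use insert in auto)
  also have "\<dots> = - (\<Sum>u\<in>Pow v. (-1) ^ card (insert j u) * T (w \<union> insert j u) {})"
    unfolding sum_negf[symmetric]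
  proof (intro sum.cong refl)
    fix u assume "u \<in> Pow v"
    then have "finite u" "j \<notin> u" using insert by (auto intro: finite_subset)
    then show "(-1) ^ card u * T (insert j w \<union> u) {} = - ((-1) ^ card (insert j u) * T (w \<union> insert j u) {})"
      by simp
  qed
  finally show ?case using insert by (simp add: sum_Pow_insert del: Un_insert_right)
qed simp

lemma two_set_recurrence_sum:
  fixes T :: "'b set \<Rightarrow> 'b set \<Rightarrow> real"
  assumes rec: "\<And>w v j. w \<subseteq> D \<Longrightarrow> v \<subseteq> D \<Longrightarrow> w \<inter> v = {} \<Longrightarrow> j \<in> D - (w \<union> v) \<Longrightarrow>
      T w v = T (insert j w) v + T w (insert j v)"
    and "finite v" "v \<subseteq> D"
  shows "T {} {} = (\<Sum>u\<in>Pow v. T u (v - u))"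
  using assms(2-)
proof (induction v rule: finite_induct)
  case (insert j v)
  have "T {} {} = (\<Sum>u\<in>Pow v. T u (v - u))" using insert by auto
  also have "\<dots> = (\<Sum>u\<in>Pow v. T u (insert j v - u) + T (insert j u) (insert j v - insert j u))"
  proof (intro sum.cong refl)
    fix u assume u: "u \<in> Pow v"
    then have "insert j v - u = insert j (v - u)" "insert j v - insert j u = v - u"
      using insert by auto
    moreover have "T u (v - u) = T (insert j u) (v - u) + T u (insert j (v - u))"
      by (rule rec) (use u insert in auto)
    ultimately show "T u (v - u) = T u (insert j v - u) + T (insert j u) (insert j v - insert j u)"
      by simp
  qed
  also have "\<dots> = (\<Sum>u\<in>Pow (insert j v). T u (insert j v - u))"
    by (simp only: sum_Pow_insert[OF insert.hyps(1,2)] sum.distrib)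
  finally show ?case .
qed simp

section \<open>Mixed expansions and remainders\<close>

context mixed_abs_cont_box
begin

text \<open>
  The multi-indices that occur when the variables \<open>w\<close> are expanded in polynomials and those in \<open>v\<close>
  contribute remainders.
\<close>

definition "orders w v = {\<tau> \<in> idx. (\<forall>j\<in>v. \<tau> j = \<alpha>) \<and> (\<forall>j\<in>D - (w \<union> v). \<tau> j = 0)}"

text \<open>The product of Bernoulli polynomials in the variables \<open>w\<close>.\<close>

definition "bernoulli_coeff x w \<tau> = (\<Prod>j\<in>w. scaled_bernoulli (a j) (b j) (\<tau> j) (x j) / fact (\<tau> j))"

text \<open>The product of the remainder kernels in the variables \<open>v\<close>.\<close>

definition "remainder_kernel x v y = (\<Prod>j\<in>v. periodic_bernoulli (a j) (b j) \<alpha> (x j - y j + a j) / fact \<alpha>)"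

text \<open>
  The integral over the variables \<open>u\<close>, weighted by the remainder kernels in \<open>v \<subseteq> u\<close>.
\<close>

definition "term_integral x u v \<tau> =
  (LINT y:box_on u a b|leb_on u. remainder_kernel x v y * F \<tau> (sec u x y))"

text \<open>
  The value at \<open>x\<close> of the function obtained from \<open>f\<close> by taking the polynomial part of the expansion
  in the variables \<open>w\<close> and the remainder, with its sign, in the variables \<open>v\<close>.
\<close>

definition "mixed_term x w v = (-1) ^ card v *
  (\<Sum>\<tau>\<in>orders w v. bernoulli_coeff x w \<tau> * term_integral x (w \<union> v) v \<tau>)"

lemma orders_tops: "\<tau> \<in> orders w v \<Longrightarrow> tops \<tau> \<subseteq> w \<union> v"
  using \<alpha> unfolding orders_def by force

text \<open>
  The expansion in the variable \<open>j\<close> is applied to every summand. In the polynomial part, the new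
  multi-indices are the \<open>\<tau>(j := k)\<close> with \<open>k \<le> \<alpha>\<close>; in the remainder, they are the \<open>\<tau>(j := \<alpha>)\<close>.
\<close>

lemma mixed_term_recurrence:
  assumes x: "x \<in> box_on D a b" and w: "w \<subseteq> D" and v: "v \<subseteq> D" and wv: "w \<inter> v = {}"
    and j: "j \<in> D - (w \<union> v)"
  shows "mixed_term x w v = mixed_term x (insert j w) v + mixed_term x w (insert j v)"
proof -
  have fin: "finite w" "finite v" using w v finite_subset by blast+
  have jj: "j \<in> D" "j \<notin> w" "j \<notin> v" "j \<notin> w \<union> v" using j by auto
  let ?u = "w \<union> v"
  have step: "term_integral x ?u v \<tau> =
     (\<Sum>k\<le>\<alpha>. scaled_bernoulli (a j) (b j) k (x j) / fact k * term_integral x (insert j ?u) v (\<tau>(j := k)))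
     - term_integral x (insert j ?u) (insert j v) (\<tau>(j := \<alpha>))" if \<tau>: "\<tau> \<in> orders w v" for \<tau>
  proof -
    have \<tau>': "\<tau> \<in> idx" "\<tau> j = 0" using \<tau> j by (auto simp: orders_def)
    obtain B where B: "\<And>y. \<bar>remainder_kernel x v y\<bar> \<le> B"
      using kernel_bounded[OF v, of \<alpha> x] unfolding remainder_kernel_def by blast
    have "(LINT y:box_on ?u a b|leb_on ?u. remainder_kernel x v y * F \<tau> (sec ?u x y)) =
      (\<Sum>k\<le>\<alpha>. scaled_bernoulli (a j) (b j) k (x j) / fact k *
          (LINT y:box_on (insert j ?u) a b|leb_on (insert j ?u).
             remainder_kernel x v y * F (\<tau>(j := \<tau> j + k)) (sec (insert j ?u) x y)))
       - (LINT y:box_on (insert j ?u) a b|leb_on (insert j ?u).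
            (periodic_bernoulli (a j) (b j) \<alpha> (x j - y j + a j) / fact \<alpha> * remainder_kernel x v y)
            * F (\<tau>(j := \<tau> j + \<alpha>)) (sec (insert j ?u) x y))"
    proof (rule section_step(2)[OF \<tau>'(1) jj(1,4) _ orders_tops[OF \<tau>] x \<alpha>])
      show "\<forall>k\<le>\<alpha>. section_integrable (\<tau>(j := \<tau> j + k)) (insert j ?u) x"
      proof (intro allI impI section_integrable_all x)
        fix k assume "k \<le> \<alpha>"
        then show "\<tau>(j := \<tau> j + k) \<in> idx" using \<tau>' jj by (intro idx_upd) auto
        show "tops (\<tau>(j := \<tau> j + k)) \<subseteq> insert j ?u" using orders_tops[OF \<tau>] by auto
      qed (use w v jj in auto)
      show "remainder_kernel x v \<in> borel_measurable (\<Pi>\<^sub>M j\<in>insert j ?u. lborel)"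
        unfolding remainder_kernel_def by (rule kernel_measurable) auto
      show "remainder_kernel x v (y(j := t)) = remainder_kernel x v y" for y t
        unfolding remainder_kernel_def using jj by (intro prod.cong) auto
    qed (use w v \<tau>' B in auto)
    moreover have "remainder_kernel x (insert j v) y =
        periodic_bernoulli (a j) (b j) \<alpha> (x j - y j + a j) / fact \<alpha> * remainder_kernel x v y" for y
      using fin jj by (simp add: remainder_kernel_def)
    ultimately show ?thesis using \<tau>' by (simp add: term_integral_def)
  qed
  have coeff_upd: "bernoulli_coeff x w (\<tau>(j := k)) = bernoulli_coeff x w \<tau>" for \<tau> k
    unfolding bernoulli_coeff_def using jj by (intro prod.cong) auto
  have coeff_insert: "bernoulli_coeff x (insert j w) (\<tau>(j := k)) =
      scaled_bernoulli (a j) (b j) k (x j) / fact k * bernoulli_coeff x w \<tau>" for \<tau> k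
    using coeff_upd[of \<tau> k] fin jj by (simp add: bernoulli_coeff_def)
  have "(\<Sum>\<tau>\<in>orders w v. bernoulli_coeff x w \<tau> * (\<Sum>k\<le>\<alpha>. scaled_bernoulli (a j) (b j) k (x j) / fact k *
        term_integral x (insert j ?u) v (\<tau>(j := k))))
     = (\<Sum>(\<tau>, k)\<in>orders w v \<times> {..\<alpha>}. bernoulli_coeff x (insert j w) (\<tau>(j := k)) * term_integral x (insert j ?u) v (\<tau>(j := k)))"
    unfolding coeff_insert by (simp add: sum.cartesian_product[symmetric] sum_distrib_left mult_ac)
  also have "\<dots> = (\<Sum>\<tau>\<in>orders (insert j w) v. bernoulli_coeff x (insert j w) \<tau> * term_integral x (insert j ?u) v \<tau>)"
  proof (rule sum.reindex_bij_witness[of _ "\<lambda>\<tau>. (\<tau>(j := 0), \<tau> j)" "\<lambda>(\<tau>, k). \<tau>(j := k)"])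
    fix z assume z: "z \<in> orders w v \<times> {..\<alpha>}"
    then have z': "fst z \<in> idx" "fst z j = 0" "snd z \<le> \<alpha>" using j by (auto simp: orders_def)
    show "(((case z of (\<tau>, k) \<Rightarrow> \<tau>(j := k)))(j := 0), (case z of (\<tau>, k) \<Rightarrow> \<tau>(j := k)) j) = z"
      using z' by (auto simp: case_prod_unfold prod_eq_iff fun_eq_iff)
    have "((fst z)(j := snd z)) i = 0" if "i \<in> D - (insert j w \<union> v)" for i
    proof -
      have "i \<noteq> j" "i \<in> D - (w \<union> v)" using that by auto
      then show ?thesis using z by (auto simp: orders_def)
    qed
    moreover have "((fst z)(j := snd z)) i = \<alpha>" if "i \<in> v" for i
      using that jj z by (auto simp: orders_def)
    ultimately show "(case z of (\<tau>, k) \<Rightarrow> \<tau>(j := k)) \<in> orders (insert j w) v"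
      using idx_upd[OF z'(1) jj(1) z'(3)] unfolding orders_def case_prod_unfold by blast
    show "bernoulli_coeff x (insert j w) (case z of (\<tau>, k) \<Rightarrow> \<tau>(j := k)) *
        term_integral x (insert j ?u) v (case z of (\<tau>, k) \<Rightarrow> \<tau>(j := k)) =
      (case z of (\<tau>, k) \<Rightarrow> bernoulli_coeff x (insert j w) (\<tau>(j := k)) * term_integral x (insert j ?u) v (\<tau>(j := k)))"
      by (simp add: case_prod_unfold)
  next
    fix \<tau> assume \<tau>: "\<tau> \<in> orders (insert j w) v"
    then have \<tau>': "\<tau> \<in> idx" by (auto simp: orders_def)
    show "(case (\<tau>(j := 0), \<tau> j) of (\<tau>, k) \<Rightarrow> \<tau>(j := k)) = \<tau>" by simp
    show "(\<tau>(j := 0), \<tau> j) \<in> orders w v \<times> {..\<alpha>}"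
      using \<tau> jj idx_upd[OF \<tau>' jj(1), of 0] PiE_mem[OF \<tau>' jj(1)] by (auto simp: orders_def)
  qed
  finally have s1: "(\<Sum>\<tau>\<in>orders w v. bernoulli_coeff x w \<tau> * (\<Sum>k\<le>\<alpha>. scaled_bernoulli (a j) (b j) k (x j) / fact k *
        term_integral x (insert j ?u) v (\<tau>(j := k))))
     = (\<Sum>\<tau>\<in>orders (insert j w) v. bernoulli_coeff x (insert j w) \<tau> * term_integral x (insert j ?u) v \<tau>)" .
  have s2: "(\<Sum>\<tau>\<in>orders w v. bernoulli_coeff x w \<tau> * term_integral x (insert j ?u) (insert j v) (\<tau>(j := \<alpha>)))
     = (\<Sum>\<tau>\<in>orders w (insert j v). bernoulli_coeff x w \<tau> * term_integral x (insert j ?u) (insert j v) \<tau>)"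
  proof (rule sum.reindex_bij_witness[of _ "\<lambda>\<tau>. \<tau>(j := 0)" "\<lambda>\<tau>. \<tau>(j := \<alpha>)"])
    fix \<tau> assume \<tau>: "\<tau> \<in> orders w v"
    then have \<tau>': "\<tau> \<in> idx" "\<tau> j = 0" using j by (auto simp: orders_def)
    show "(\<tau>(j := \<alpha>))(j := 0) = \<tau>" using \<tau>' by (auto simp: fun_eq_iff)
    show "\<tau>(j := \<alpha>) \<in> orders w (insert j v)"
      using \<tau> jj idx_upd[OF \<tau>'(1) jj(1), of \<alpha>] by (auto simp: orders_def)
    show "bernoulli_coeff x w (\<tau>(j := \<alpha>)) * term_integral x (insert j ?u) (insert j v) (\<tau>(j := \<alpha>)) =
      bernoulli_coeff x w \<tau> * term_integral x (insert j ?u) (insert j v) (\<tau>(j := \<alpha>))" by (simp add: coeff_upd)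
  next
    fix \<tau> assume \<tau>: "\<tau> \<in> orders w (insert j v)"
    then have \<tau>': "\<tau> \<in> idx" "\<tau> j = \<alpha>" by (auto simp: orders_def)
    show "(\<tau>(j := 0))(j := \<alpha>) = \<tau>" using \<tau>' by (auto simp: fun_eq_iff)
    show "\<tau>(j := 0) \<in> orders w v"
      using \<tau> jj idx_upd[OF \<tau>'(1) jj(1), of 0] by (auto simp: orders_def)
  qed
  have "(\<Sum>\<tau>\<in>orders w v. bernoulli_coeff x w \<tau> * term_integral x ?u v \<tau>) =
     (\<Sum>\<tau>\<in>orders w v. bernoulli_coeff x w \<tau> * (\<Sum>k\<le>\<alpha>. scaled_bernoulli (a j) (b j) k (x j) / fact k *
        term_integral x (insert j ?u) v (\<tau>(j := k)))
       - bernoulli_coeff x w \<tau> * term_integral x (insert j ?u) (insert j v) (\<tau>(j := \<alpha>)))"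
    by (intro sum.cong refl) (simp only: step right_diff_distrib)
  also have "\<dots> = (\<Sum>\<tau>\<in>orders (insert j w) v. bernoulli_coeff x (insert j w) \<tau> * term_integral x (insert j ?u) v \<tau>)
     - (\<Sum>\<tau>\<in>orders w (insert j v). bernoulli_coeff x w \<tau> * term_integral x (insert j ?u) (insert j v) \<tau>)"
    unfolding sum_subtractf s1 s2 ..
  finally show ?thesis
    using fin jj by (simp add: mixed_term_def right_diff_distrib)
qed

lemma mixed_deriv_zero:
  assumes "\<forall>j\<in>D. \<tau> j = 0"
  shows "F \<tau> = f"
proof -
  have "foldr (\<lambda>j. partial_deriv a b j ^^ \<tau> j) js f = f" if "set js \<subseteq> D" for js
    using that assms by (induction js) auto
  moreover have "set [1..<Suc d] \<subseteq> D" by auto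
  ultimately show ?thesis unfolding mixed_deriv_def by blast
qed

lemma mixed_term_empty:
  assumes x: "x \<in> box_on D a b"
  shows "mixed_term x {} {} = f x"
proof -
  have o: "orders {} {} = {\<lambda>j\<in>D. 0}"
    by (auto simp: orders_def PiE_iff extensional_def fun_eq_iff restrict_def)
  have ex: "x \<in> extensional D" using x by (auto simp: box_on_def PiE_iff)
  let ?g = "\<lambda>y. indicator (box_on {} a b) y *\<^sub>R f x"
  have "(LINT y:box_on {} a b|leb_on {}. f x) = (LINT y|(\<Pi>\<^sub>M j\<in>{}. lborel :: real measure). ?g y)"
    unfolding set_lebesgue_integral_def leb_on_def
    by (rule integrable_completionI(2)) (simp_all add: PiM_empty integrable_count_space)
  also have "\<dots> = f x"
    by (simp add: PiM_empty lebesgue_integral_count_space_finite box_on_def)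
  finally have "(LINT y:box_on {} a b|leb_on {}. f x) = f x" .
  moreover have "F (\<lambda>j\<in>D. 0) = f" by (rule mixed_deriv_zero) simp
  ultimately have "term_integral x {} {} (\<lambda>j\<in>D. 0) = f x"
    unfolding term_integral_def sec_empty[OF ex] remainder_kernel_def by simp
  then show ?thesis by (simp add: mixed_term_def o bernoulli_coeff_def)
qed

lemma section_integral_kernel:
  assumes "\<tau> \<in> idx" "tops \<tau> \<subseteq> u" "v \<subseteq> u" "u \<subseteq> D" "x \<in> box_on D a b"
  shows "set_integrable (leb_on u) (box_on u a b) (\<lambda>y. remainder_kernel x v y * F \<tau> (sec u x y))"
proof -
  obtain B where B: "\<And>y. \<bar>remainder_kernel x v y\<bar> \<le> B"
    using kernel_bounded[of v \<alpha> x] assms(3,4) unfolding remainder_kernel_def by blast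
  show ?thesis
    using section_integrable_all[OF assms(1,2,4,5)] kernel_measurable[OF assms(3), of \<alpha> x] B
    unfolding section_integrable_def remainder_kernel_def[symmetric] by (rule set_integrable_leb_on_mult_bounded)
qed

lemma indicator_box_sec_D:
  "indicator (box_on D a b) y *\<^sub>R (k * F \<tau> (sec D x y)) = indicator (box_on D a b) y *\<^sub>R (k * F \<tau> y)"
proof (cases "y \<in> box_on D a b")
  case True
  then have "y \<in> extensional D" by (auto simp: box_on_def PiE_iff)
  then show ?thesis by (simp only: sec_D)
qed simp

lemma term_integral_D: "term_integral x D v \<tau> =
    (LINT y:box_on D a b|leb_on D. remainder_kernel x v y * F \<tau> y)"
  unfolding term_integral_def set_lebesgue_integral_def indicator_box_sec_D ..

end

section \<open>The two representations\<close>

theorem proposition4: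
  fixes d \<alpha> :: nat
    and a b :: "nat \<Rightarrow> real"
    and f :: "(nat \<Rightarrow> real) \<Rightarrow> real"
    and x :: "nat \<Rightarrow> real"
  assumes "1 \<le> d" and "1 \<le> \<alpha>"
    and "\<And>j. j \<in> {1..d} \<Longrightarrow> a j < b j"
    and "mixed_abs_cont d \<alpha> a b f"
    and "top_derivs_integrable d \<alpha> a b f"
    and "x \<in> box_on {1..d} a b"
  shows
    \<comment> \<open>all the integrals in the two representations exist\<close>
    "(\<forall>u\<in>Pow {1..d}. \<forall>\<tau>\<in>{\<tau> \<in> {1..d} \<rightarrow>\<^sub>E {0..\<alpha>}. \<forall>j\<in>{1..d} - u. \<tau> j = 0}.
        set_integrable (leb_on u) (box_on u a b)
          (\<lambda>y. mixed_deriv d a b \<tau> f (merge ({1..d} - u) u (x, y)))) \<and>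
     (\<forall>u\<in>Pow {1..d}. \<forall>\<tau>\<in>{\<tau> \<in> {1..d} \<rightarrow>\<^sub>E {0..\<alpha>}. \<forall>j\<in>{1..d} - u. \<tau> j = \<alpha>}.
        set_integrable (leb_on {1..d}) (box_on {1..d} a b)
          (\<lambda>y. (\<Prod>j\<in>{1..d} - u. periodic_bernoulli (a j) (b j) \<alpha> (x j - y j + a j) / fact \<alpha>)
             * mixed_deriv d a b \<tau> f y)) \<and>
     f x =
       (\<Sum>u\<in>Pow {1..d} - {{}}. (- 1) ^ (card u + 1) *
          (\<Sum>\<tau>\<in>{\<tau> \<in> {1..d} \<rightarrow>\<^sub>E {0..\<alpha>}. \<forall>j\<in>{1..d} - u. \<tau> j = 0}.
             (\<Prod>j\<in>u. scaled_bernoulli (a j) (b j) (\<tau> j) (x j) / fact (\<tau> j)) *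
             (LINT y:box_on u a b|leb_on u.
                mixed_deriv d a b \<tau> f (merge ({1..d} - u) u (x, y)))))
       + (- 1) ^ d *
          (LINT y:box_on {1..d} a b|leb_on {1..d}.
             (\<Prod>j=1..d. periodic_bernoulli (a j) (b j) \<alpha> (x j - y j + a j) / fact \<alpha>)
             * mixed_deriv d a b (\<lambda>j\<in>{1..d}. \<alpha>) f y) \<and>
     f x =
       (\<Sum>u\<in>Pow {1..d}. (- 1) ^ (d - card u) *
          (\<Sum>\<tau>\<in>{\<tau> \<in> {1..d} \<rightarrow>\<^sub>E {0..\<alpha>}. \<forall>j\<in>{1..d} - u. \<tau> j = \<alpha>}.
             (\<Prod>j\<in>u. scaled_bernoulli (a j) (b j) (\<tau> j) (x j) / fact (\<tau> j)) *
             (LINT y:box_on {1..d} a b|leb_on {1..d}.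
                (\<Prod>j\<in>{1..d} - u. periodic_bernoulli (a j) (b j) \<alpha> (x j - y j + a j) / fact \<alpha>)
                * mixed_deriv d a b \<tau> f y)))"
proof -
  interpret mixed_abs_cont_box d \<alpha> a b f
    using assms by unfold_locales
  note x = assms(6)
  let ?T = "mixed_term x"
  have rec: "?T w v = ?T (insert j w) v + ?T w (insert j v)"
    if "w \<subseteq> D" "v \<subseteq> D" "w \<inter> v = {}" "j \<in> D - (w \<union> v)" for w v j
    by (rule mixed_term_recurrence[OF x that])
  have orders1: "orders u {} = {\<tau> \<in> idx. \<forall>j\<in>D - u. \<tau> j = 0}" for u
    by (simp add: orders_def)
  have orders2: "orders u (D - u) = {\<tau> \<in> idx. \<forall>j\<in>D - u. \<tau> j = \<alpha>}" if "u \<subseteq> D" for u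
    by (auto simp: orders_def)
  have orders3: "orders {} D = {\<lambda>j\<in>D. \<alpha>}"
    by (auto simp: orders_def PiE_iff extensional_def fun_eq_iff restrict_def)
  have T1: "?T u {} = (\<Sum>\<tau>\<in>{\<tau> \<in> idx. \<forall>j\<in>D - u. \<tau> j = 0}.
     (\<Prod>j\<in>u. scaled_bernoulli (a j) (b j) (\<tau> j) (x j) / fact (\<tau> j)) *
     (LINT y:box_on u a b|leb_on u. F \<tau> (sec u x y)))" for u
    unfolding mixed_term_def orders1 bernoulli_coeff_def term_integral_def remainder_kernel_def by simp
  have T2: "?T u (D - u) = (- 1) ^ (d - card u) * (\<Sum>\<tau>\<in>{\<tau> \<in> idx. \<forall>j\<in>D - u. \<tau> j = \<alpha>}.
     (\<Prod>j\<in>u. scaled_bernoulli (a j) (b j) (\<tau> j) (x j) / fact (\<tau> j)) *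
     (LINT y:box_on D a b|leb_on D.
        (\<Prod>j\<in>D - u. periodic_bernoulli (a j) (b j) \<alpha> (x j - y j + a j) / fact \<alpha>) * F \<tau> y))"
    if u: "u \<subseteq> D" for u
  proof -
    have "u \<union> (D - u) = D" "card (D - u) = d - card u"
      using u by (auto simp: card_Diff_subset finite_subset)
    then show ?thesis
      unfolding mixed_term_def orders2[OF u] by (simp only: term_integral_D bernoulli_coeff_def remainder_kernel_def)
  qed
  have T3: "?T {} D = (- 1) ^ d * (LINT y:box_on D a b|leb_on D.
     (\<Prod>j=1..d. periodic_bernoulli (a j) (b j) \<alpha> (x j - y j + a j) / fact \<alpha>) * F (\<lambda>j\<in>D. \<alpha>) y)"
    unfolding mixed_term_def orders3 Un_empty_left term_integral_D by (simp add: bernoulli_coeff_def remainder_kernel_def)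
  have i1: "set_integrable (leb_on u) (box_on u a b) (\<lambda>y. F \<tau> (sec u x y))"
    if "u \<in> Pow D" "\<tau> \<in> {\<tau> \<in> idx. \<forall>j\<in>D - u. \<tau> j = 0}" for u \<tau>
  proof -
    have "tops \<tau> \<subseteq> u" using orders_tops[of \<tau> u "{}"] that by (simp add: orders1)
    then show ?thesis
      using section_integrable_all[of \<tau> u x] that x by (auto simp: section_integrable_def)
  qed
  have i2: "set_integrable (leb_on D) (box_on D a b)
      (\<lambda>y. (\<Prod>j\<in>D - u. periodic_bernoulli (a j) (b j) \<alpha> (x j - y j + a j) / fact \<alpha>) * F \<tau> y)"
    if "\<tau> \<in> {\<tau> \<in> idx. \<forall>j\<in>D - u. \<tau> j = \<alpha>}" for u \<tau>
  proof -
    have "set_integrable (leb_on D) (box_on D a b) (\<lambda>y. remainder_kernel x (D - u) y * F \<tau> (sec D x y))"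
      using that x by (intro section_integral_kernel) auto
    then show ?thesis
      unfolding set_integrable_def indicator_box_sec_D unfolding remainder_kernel_def .
  qed
  have "?T {} D = (\<Sum>u\<in>Pow D. (-1) ^ card u * ?T ({} \<union> u) {})"
    by (rule two_set_recurrence_inclusion_exclusion[where D=D]) (use rec in auto)
  also have "\<dots> = f x + (\<Sum>u\<in>Pow D - {{}}. (-1) ^ card u * ?T u {})"
    by (subst sum.remove[of _ "{}"]) (auto simp: mixed_term_empty[OF x])
  finally have e1: "f x = (\<Sum>u\<in>Pow D - {{}}. (-1) ^ (card u + 1) * ?T u {}) + ?T {} D"
    by (simp add: sum_negf)
  have "?T {} {} = (\<Sum>u\<in>Pow D. ?T u (D - u))"
    by (rule two_set_recurrence_sum[where D=D]) (use rec in auto)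
  then have e2: "f x = (\<Sum>u\<in>Pow D. ?T u (D - u))"
    by (simp only: mixed_term_empty[OF x])
  show ?thesis
  proof (intro conjI ballI)
    show "f x = (\<Sum>u\<in>Pow D - {{}}. (- 1) ^ (card u + 1) *
          (\<Sum>\<tau>\<in>{\<tau> \<in> idx. \<forall>j\<in>D - u. \<tau> j = 0}.
             (\<Prod>j\<in>u. scaled_bernoulli (a j) (b j) (\<tau> j) (x j) / fact (\<tau> j)) *
             (LINT y:box_on u a b|leb_on u. F \<tau> (sec u x y))))
       + (- 1) ^ d * (LINT y:box_on D a b|leb_on D.
             (\<Prod>j=1..d. periodic_bernoulli (a j) (b j) \<alpha> (x j - y j + a j) / fact \<alpha>) * F (\<lambda>j\<in>D. \<alpha>) y)"
      using e1 unfolding T1 T3 .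
    show "f x = (\<Sum>u\<in>Pow D. (- 1) ^ (d - card u) *
          (\<Sum>\<tau>\<in>{\<tau> \<in> idx. \<forall>j\<in>D - u. \<tau> j = \<alpha>}.
             (\<Prod>j\<in>u. scaled_bernoulli (a j) (b j) (\<tau> j) (x j) / fact (\<tau> j)) *
             (LINT y:box_on D a b|leb_on D.
                (\<Prod>j\<in>D - u. periodic_bernoulli (a j) (b j) \<alpha> (x j - y j + a j) / fact \<alpha>) * F \<tau> y)))"
      unfolding e2 by (intro sum.cong refl) (simp only: T2 Pow_iff)
  qed (rule i1, assumption+, rule i2, assumption)
qed

end
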